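(* Let $r,s,m,n \in \mathbb{N}$ with $s \leq r \leq \min\{m,n\}$ and let $K$ be a field with cardinality greater than or equal to $r+2$ and characteristic different from $2$. Then $$a^K(m \times n; s,r) = r \max\{m,n\} - \binom{s+1}{2}.$$
   Context: $\mathbb{N}$ includes $0$. $K^{m \times n}$ denotes the vector space of $(m \times n)$-matrices over $K$, and $rk$ denotes the rank. Let $\mathcal{A}^K(m \times n; s,r)$ be the set of all (nonempty) affine subspaces $S$ of $K^{m \times n}$ such that $s = \min\{rk(A) \mid A \in S\}$ and $r = \max\{rk(A) \mid A \in S\}$. Define $a^K(m \times n; s,r) = \max\{\dim S \mid S \in \mathcal{A}^K(m \times n; s,r)\}$. *)

theory Defs
  imports "Jordan_Normal_Form.DL_Rank"
begin

definition affine_mat_subspace :: "nat \<Rightarrow> nat \<Rightarrow> 'a::field mat set \<Rightarrow> bool" where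
  "affine_mat_subspace m n S \<longleftrightarrow>
     (\<exists>A\<in>carrier_mat m n. \<exists>W. VectorSpace.subspace class_ring W (module_mat TYPE('a) m n) \<and>
        S = (\<lambda>B. A + B) ` W)"

text \<open>For \<open>S = A + W\<close> with \<open>W\<close> a linear subspace, the set of differences is \<open>W\<close>,
  so the direction, and hence the dimension, does not depend on the choice of \<open>A\<close>.\<close>

definition direction :: "'a::field mat set \<Rightarrow> 'a mat set" where
  "direction S = {B - A | A B. A \<in> S \<and> B \<in> S}"

definition affine_dim :: "nat \<Rightarrow> nat \<Rightarrow> 'a::field mat set \<Rightarrow> nat" where
  "affine_dim m n S =
     vectorspace.dim class_ring ((module_mat TYPE('a) m n)\<lparr>carrier := direction S\<rparr>)"

text \<open>The first argument of \<open>vec_space.rank\<close> is the number of rows. The ranks in \<open>S\<close> form a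
  nonempty set bounded by \<open>n\<close>, and the dimensions below are bounded by \<open>m * n\<close>, so \<open>Min\<close> and
  \<open>Max\<close> are applied to finite sets.\<close>

definition affine_rank_spaces ::
  "'a::field itself \<Rightarrow> nat \<Rightarrow> nat \<Rightarrow> nat \<Rightarrow> nat \<Rightarrow> 'a mat set set" where
  "affine_rank_spaces _ m n s r =
     {S. affine_mat_subspace m n S \<and>
         s = Min (vec_space.rank m ` S) \<and> r = Max (vec_space.rank m ` S)}"

definition max_affine_dim :: "'a::field itself \<Rightarrow> nat \<Rightarrow> nat \<Rightarrow> nat \<Rightarrow> nat \<Rightarrow> nat" where
  "max_affine_dim K m n s r = Max (affine_dim m n ` affine_rank_spaces K m n s r)"

end

theory Submission
  imports Defs
begin

text \<open>
  Write a competing affine space as \<open>A + V\<close> with \<open>V\<close> linear. To bound \<open>dim V\<close> by \<open>d\<close> it suffices to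
  name \<open>d\<close> linear functionals whose common kernel meets \<open>V\<close> only in 0. This notion, \<open>separated\<close>,
  replaces all exact sequences of the classical arguments: restricting to a common kernel and then
  separating what is left simply adds the numbers of functionals. In all three steps below the
  functionals are matrix entries, after a change of bases.

  Upper rank bound. Let \<open>A\<close> have the maximal rank \<open>r\<close>; after a change of bases it is the identity block
  of size \<open>r\<close>. Split \<open>B\<close> in \<open>V\<close> into blocks accordingly. The \<open>(r+1)\<close>-minors of \<open>A + tB\<close> containing
  the identity block are polynomials in \<open>t\<close> of degree at most \<open>r + 1\<close> that vanish on the whole field,
  hence identically, as the field has at least \<open>r + 2\<close> elements. Their coefficients of \<open>t\<close> and \<open>t\<^sup>2\<close> give \<open>B22 = 0\<close> and \<open>B21 B12 = 0\<close>
  (\<open>rank_pencil_blocks\<close>). So the pairs \<open>(B21, B12)\<close> form a totally isotropic space for a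
  hyperbolic form, and \<open>r (max m n - r)\<close> entries suffice to kill them (\<open>isotropic_coordinates\<close>). What
  is left is the space of the blocks \<open>B11\<close>, for which all \<open>1 + B11\<close> have rank at least \<open>s\<close>.

  Lower rank bound. An affine space of \<open>m\<close> by \<open>n\<close> matrices of rank at least \<open>s\<close> has codimension at least
  \<open>s (s + 1) / 2\<close> (\<open>separated_if_rank_ge\<close>). Take a matrix of minimal rank \<open>k\<close>, again in the form of an
  identity block, and kill all entries outside that block. The directions \<open>X\<close> that remain live on
  the \<open>k\<close> by \<open>k\<close> block and, by minimality of \<open>k\<close>, none of them fixes a nonzero vector.

  Spaces without fixed vectors. Over a field with more than \<open>k\<close> elements, a linear space of \<open>k\<close> by \<open>k\<close>
  matrices, none of which fixes a nonzero vector, has dimension at most \<open>k (k - 1) / 2\<close>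
  (\<open>fixed_point_free_coordinates\<close>): for some \<open>i\<close> the space contains no nonzero matrix supported in
  row \<open>i\<close>, so after killing the \<open>k - 1\<close> off-diagonal entries of column \<open>i\<close>, both row and column \<open>i\<close>
  can be deleted.

  The bound is attained by matrices supported in the first \<open>r\<close> columns (if \<open>n \<le> m\<close>) or rows (if
  \<open>m < n\<close>) whose leading \<open>s\<close> by \<open>s\<close> block is unit upper triangular.
\<close>

section \<open>Dimension bounds by separating functionals\<close>

text \<open>Gaussian elimination on the equations: an equation with a nonzero coefficient at \<open>z\<close> is used to
  eliminate the unknown at \<open>z\<close> from the others, and is solved for it at the end.\<close>

lemma homogeneous_system_nontrivial:
  fixes f :: "'k \<Rightarrow> 'x \<Rightarrow> 'a::field"
  assumes "finite K" and "finite A" and "card K < card A"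
  shows "\<exists>a. (\<exists>x\<in>A. a x \<noteq> 0) \<and> (\<forall>k\<in>K. (\<Sum>x\<in>A. a x * f k x) = 0)"
  using assms
proof (induction K arbitrary: A f rule: finite_induct)
  case empty
  then have "A \<noteq> {}" by auto
  then show ?case by (intro exI[of _ "\<lambda>_. 1"]) auto
next
  case (insert k K)
  show ?case
  proof (cases "\<forall>x\<in>A. f k x = 0")
    case True
    obtain a where "\<exists>x\<in>A. a x \<noteq> 0" "\<forall>k\<in>K. (\<Sum>x\<in>A. a x * f k x) = 0"
      using insert.IH[of A f] insert.prems insert.hyps by auto
    with True show ?thesis by (intro exI[of _ a]) auto
  next
    case False
    then obtain z where z: "z \<in> A" "f k z \<noteq> 0" by auto
    let ?A = "A - {z}"
    have "card K < card ?A" using insert z by auto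
    from insert.IH[OF _ this, of "\<lambda>j x. f j x - f j z * f k x / f k z"]
    obtain b where b: "\<exists>x\<in>?A. b x \<noteq> 0"
        "\<forall>j\<in>K. (\<Sum>x\<in>?A. b x * (f j x - f j z * f k x / f k z)) = 0"
      using insert.prems by auto
    define c where "c = - (\<Sum>x\<in>?A. b x * f k x) / f k z"
    define a where "a = b(z := c)"
    have split: "(\<Sum>x\<in>A. a x * f j x) = c * f j z + (\<Sum>x\<in>?A. b x * f j x)" for j
    proof -
      have "(\<Sum>x\<in>A. a x * f j x) = a z * f j z + (\<Sum>x\<in>?A. a x * f j x)"
        using z insert.prems by (simp add: sum.remove)
      also have "(\<Sum>x\<in>?A. a x * f j x) = (\<Sum>x\<in>?A. b x * f j x)"
        by (rule sum.cong) (auto simp: a_def)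
      finally show ?thesis by (simp add: a_def)
    qed
    have "(\<Sum>x\<in>A. a x * f j x) = 0" if "j \<in> insert k K" for j
    proof (cases "j = k")
      case True
      then show ?thesis using z by (simp add: split c_def)
    next
      case False
      then have "(\<Sum>x\<in>?A. b x * (f j x - f j z * f k x / f k z)) = 0" using that b by auto
      moreover have "(\<Sum>x\<in>?A. b x * (f j x - f j z * f k x / f k z))
          = (\<Sum>x\<in>?A. b x * f j x) + c * f j z"
        by (simp add: c_def algebra_simps sum_subtractf sum_distrib_left sum_divide_distrib)
      ultimately show ?thesis by (simp add: split add.commute)
    qed
    moreover have "\<exists>x\<in>A. a x \<noteq> 0" using b by (auto simp: a_def)
    ultimately show ?thesis by blast
  qed
qed

definition linear_mats :: "nat \<Rightarrow> nat \<Rightarrow> 'a::field mat set \<Rightarrow> bool" where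
  "linear_mats m n V \<longleftrightarrow> V \<subseteq> carrier_mat m n \<and> 0\<^sub>m m n \<in> V \<and>
     (\<forall>A\<in>V. \<forall>B\<in>V. A + B \<in> V) \<and> (\<forall>c. \<forall>A\<in>V. c \<cdot>\<^sub>m A \<in> V)"

lemma subspace_iff_linear_mats:
  "VectorSpace.subspace class_ring V (module_mat TYPE('a::field) m n) \<longleftrightarrow> linear_mats m n V"
proof
  interpret matrix_vs m n "TYPE('a)" .
  assume "VectorSpace.subspace class_ring V (module_mat TYPE('a::field) m n)"
  then interpret S: submodule class_ring V "module_mat TYPE('a::field) m n"
    by (simp add: VectorSpace.subspace_def)
  show "linear_mats m n V"
    unfolding linear_mats_def
    using S.subset S.zero_closed S.m_closed S.smult_closed
    by (auto simp: matrix_vs_simps)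
next
  interpret matrix_vs m n "TYPE('a)" .
  assume "linear_mats m n V"
  then show "VectorSpace.subspace class_ring V (module_mat TYPE('a::field) m n)"
    unfolding VectorSpace.subspace_def linear_mats_def submodule_def
    using matrix_vs[of m n] module_axioms
    by (auto simp: matrix_vs_simps)
qed

definition mat_functional :: "nat \<Rightarrow> nat \<Rightarrow> ('a::field mat \<Rightarrow> 'a) \<Rightarrow> bool" where
  "mat_functional m n f \<longleftrightarrow>
     (\<forall>A\<in>carrier_mat m n. \<forall>B\<in>carrier_mat m n. f (A + B) = f A + f B) \<and>
     (\<forall>c. \<forall>A\<in>carrier_mat m n. f (c \<cdot>\<^sub>m A) = c * f A)"

context matrix_vs
begin

lemma functional_lincomb:
  assumes "finite A" and "A \<subseteq> carrier_mat nr nc" and f: "mat_functional nr nc f"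
  shows "f (lincomb a A) = (\<Sum>x\<in>A. a x * f x)"
  using assms(1,2)
proof (induction A rule: finite_induct)
  case empty
  have "f (0 \<cdot>\<^sub>m 0\<^sub>m nr nc) = 0" using f unfolding mat_functional_def by (metis mult_zero_left zero_carrier_mat)
  then show ?case by (simp add: lincomb_def)
next
  case (insert x A)
  have "lincomb a (insert x A) = a x \<cdot>\<^sub>m x + lincomb a A"
    unfolding lincomb_def using insert by (subst finsum_insert) (auto simp: subset_iff)
  moreover have "lincomb a A \<in> carrier_mat nr nc" using insert by (intro lincomb_closed) auto
  ultimately show ?case using insert f unfolding mat_functional_def by auto
qed

end

text \<open>Equivalent to \<open>dim V \<le> d\<close>. The functionals live on the whole matrix space, so a family separating a
  subspace can be combined with one cutting out that subspace without extending anything.\<close>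

definition separated :: "nat \<Rightarrow> nat \<Rightarrow> 'a::field mat set \<Rightarrow> nat \<Rightarrow> bool" where
  "separated m n V d \<longleftrightarrow> (\<exists>F. finite F \<and> card F \<le> d \<and> (\<forall>f\<in>F. mat_functional m n f) \<and>
     (\<forall>B\<in>V. (\<forall>f\<in>F. f B = 0) \<longrightarrow> B = 0\<^sub>m m n))"

text \<open>More than \<open>d\<close> matrices of \<open>V\<close> have a nontrivial linear combination on which all \<open>d\<close> functionals
  vanish; that combination is 0, so the matrices are dependent. Hence independent subsets of \<open>V\<close>
  have at most \<open>d\<close> elements, and a maximal one is a basis.\<close>

lemma dim_le_if_separated:
  assumes V: "linear_mats m n (V :: 'a::field mat set)" and sep: "separated m n V d"
  shows "vectorspace.fin_dim class_ring ((module_mat TYPE('a) m n)\<lparr>carrier := V\<rparr>)"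
    and "vectorspace.dim class_ring ((module_mat TYPE('a) m n)\<lparr>carrier := V\<rparr>) \<le> d"
proof -
  interpret matrix_vs m n "TYPE('a)" .
  let ?M = "(module_mat TYPE('a) m n)\<lparr>carrier := V\<rparr>"
  from V have sub: "VectorSpace.subspace class_ring V (module_mat TYPE('a) m n)"
    by (simp add: subspace_iff_linear_mats)
  then have subm: "submodule class_ring V (module_mat TYPE('a) m n)"
    by (simp add: VectorSpace.subspace_def)
  interpret W: vectorspace class_ring ?M using subspace_is_vs[OF sub] by simp
  from sep obtain F where F: "finite F" "card F \<le> d" "\<forall>f\<in>F. mat_functional m n f"
      "\<forall>B\<in>V. (\<forall>f\<in>F. f B = 0) \<longrightarrow> B = 0\<^sub>m m n"
    unfolding separated_def by metis
  have VM: "V \<subseteq> carrier_mat m n" using V by (simp add: linear_mats_def)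
  have small: "card A \<le> d" if A: "finite A" "A \<subseteq> V" "lin_indpt A" for A
  proof (rule ccontr)
    assume "\<not> card A \<le> d"
    then have "card F < card A" using F by simp
    then obtain a where a: "\<exists>x\<in>A. a x \<noteq> 0" "\<forall>f\<in>F. (\<Sum>x\<in>A. a x * f x) = 0"
      using homogeneous_system_nontrivial[OF F(1) A(1), of "\<lambda>f x. f x"] by auto
    have "lincomb a A \<in> span A" using A by (auto simp: span_def)
    moreover have "span A \<subseteq> V" using span_is_subset[OF A(2) subm] .
    ultimately have "lincomb a A \<in> V" by auto
    moreover have "f (lincomb a A) = 0" if "f \<in> F" for f
      using functional_lincomb[of A f a] A VM F(3) a(2) that by auto
    ultimately have "lincomb a A = 0\<^sub>m m n" using F(4) by auto
    then have "lin_dep A" using a(1) A(1) unfolding lin_dep_def by (intro exI[of _ A] exI[of _ a]) auto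
    with A show False by simp
  qed
  let ?P = "\<lambda>A. A \<subseteq> carrier ?M \<and> W.lin_indpt A"
  have li: "W.lin_indpt A \<longleftrightarrow> lin_indpt A" if "A \<subseteq> V" for A
    using span_li_not_depend(2)[OF that subm] by simp
  have P: "finite A \<and> card A \<le> d" if "?P A" for A
  proof -
    have AV: "A \<subseteq> V" "lin_indpt A" using that li by auto
    have fin: "finite A"
    proof (rule ccontr)
      assume "infinite A"
      then obtain B where B: "B \<subseteq> A" "finite B" "card B = Suc d"
        using infinite_arbitrarily_large by blast
      then have "lin_indpt B" using AV(2) subset_li_is_li by blast
      then show False using small[of B] B AV by auto
    qed
    then show ?thesis using small AV by auto
  qed
  have P0: "?P {}" by (auto simp: W.lin_dep_def)
  obtain A where A: "finite A" "maximal A ?P"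
    using maximal_exists[of ?P d "{}", OF P P0] by blast
  then have bas: "W.basis A" by (intro W.max_li_is_basis)
  show "W.fin_dim" using bas A(1) unfolding W.basis_def W.fin_dim_def by blast
  have "W.dim = card A" using W.dim_basis[OF A(1) bas] .
  moreover have "?P A" using A(2) by (simp add: maximal_def)
  ultimately show "W.dim \<le> d" using P by auto
qed

definition coordinate_mats :: "nat \<Rightarrow> nat \<Rightarrow> (nat \<times> nat) set \<Rightarrow> 'a::field mat set" where
  "coordinate_mats m n P = {A \<in> carrier_mat m n. \<forall>i<m. \<forall>j<n. (i,j) \<notin> P \<longrightarrow> A $$ (i,j) = 0}"

lemma linear_mats_coordinate_mats: "linear_mats m n (coordinate_mats m n P)"
  by (auto simp: linear_mats_def coordinate_mats_def)

lemma mat_functional_entry: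
  assumes "i < m" "j < n" shows "mat_functional m n (\<lambda>A. A $$ (i,j))"
  using assms by (auto simp: mat_functional_def)

text \<open>The elementary matrices at the positions in \<open>P\<close> are independent.\<close>

lemma card_le_dim_coordinate_mats:
  assumes P: "P \<subseteq> {..<m} \<times> {..<n}"
    and findim: "vectorspace.fin_dim class_ring ((module_mat TYPE('a::field) m n)\<lparr>carrier := coordinate_mats m n P\<rparr>)"
  shows "card P \<le> vectorspace.dim class_ring
    ((module_mat TYPE('a) m n)\<lparr>carrier := coordinate_mats m n P\<rparr>)"
proof -
  interpret matrix_vs m n "TYPE('a)" .
  let ?V = "coordinate_mats m n P :: 'a mat set"
  let ?M = "(module_mat TYPE('a) m n)\<lparr>carrier := ?V\<rparr>"
  have sub: "VectorSpace.subspace class_ring ?V (module_mat TYPE('a) m n)"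
    by (simp add: subspace_iff_linear_mats linear_mats_coordinate_mats)
  then have subm: "submodule class_ring ?V (module_mat TYPE('a) m n)"
    by (simp add: VectorSpace.subspace_def)
  interpret W: vectorspace class_ring ?M using subspace_is_vs[OF sub] by simp
  define E :: "nat \<times> nat \<Rightarrow> 'a mat" where "E p = mat m n (\<lambda>q. if q = p then 1 else 0)" for p
  have inj: "inj_on E P"
  proof (rule inj_onI)
    fix p q assume pq: "p \<in> P" "q \<in> P" "E p = E q"
    obtain i j where ij: "p = (i,j)" "i < m" "j < n" using P pq by auto
    have "E p $$ (i,j) = 1" using ij by (simp add: E_def)
    then have "E q $$ (i,j) = 1" using pq by simp
    then show "p = q" using ij by (auto simp: E_def split: if_splits)
  qed
  have EV: "E ` P \<subseteq> ?V" using P by (auto simp: E_def coordinate_mats_def split: if_splits)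
  have "lin_indpt (E ` P)"
  proof
    assume "lin_dep (E ` P)"
    then obtain A a v where A: "finite A" "A \<subseteq> E ` P" "lincomb a A = 0\<^sub>m m n" "v \<in> A" "a v \<noteq> 0"
      unfolding lin_dep_def by auto
    then obtain i j where ij: "v = E (i,j)" "(i,j) \<in> P" by auto
    then have lt: "i < m" "j < n" using P by auto
    have "0 = lincomb a A $$ (i,j)" using A lt by simp
    also have "\<dots> = (\<Sum>x\<in>A. a x * x $$ (i,j))"
      using A EV by (intro functional_lincomb mat_functional_entry lt) (auto simp: coordinate_mats_def)
    also have "\<dots> = (\<Sum>x\<in>A. if x = v then a v else 0)"
    proof (rule sum.cong[OF refl])
      fix x assume "x \<in> A"
      then obtain p where "p \<in> P" "x = E p" using A by auto
      then show "a x * x $$ (i,j) = (if x = v then a v else 0)"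
        using ij lt inj_onD[OF inj, of p "(i,j)"] by (auto simp: E_def)
    qed
    also have "\<dots> = a v" using A by simp
    finally show False using A by simp
  qed
  then have "W.lin_indpt (E ` P)" using span_li_not_depend(2)[OF EV subm] by simp
  then have "card (E ` P) \<le> W.dim" using EV findim by (intro W.li_le_dim) auto
  then show ?thesis using card_image[OF inj] by simp
qed

section \<open>Rank and factorizations\<close>

lemma (in vec_space) col_in_span_basis:
  assumes A: "A \<in> carrier_mat n nc" and S: "maximal S (\<lambda>T. T \<subseteq> set (cols A) \<and> lin_indpt T)"
    and c: "c \<in> set (cols A)"
  shows "c \<in> span S"
proof (rule ccontr)
  assume ns: "c \<notin> span S"
  have li: "lin_indpt S" and sub: "S \<subseteq> set (cols A)" using S by (auto simp: maximal_def)
  have carr: "set (cols A) \<subseteq> carrier_vec n" using A cols_dim by blast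
  then have SC: "S \<subseteq> carrier_vec n" and cC: "c \<in> carrier_vec n" using sub c by auto
  have "c \<notin> S" using ns span_mem[OF SC] by blast
  then have "lin_indpt (S \<union> {c})" using lin_dep_iff_in_span[OF SC li cC] ns by blast
  moreover have "S \<union> {c} \<subseteq> set (cols A)" using sub c by auto
  ultimately have "S \<union> {c} = S"
    using conjunct2[OF S[unfolded maximal_def], rule_format, of "S \<union> {c}"] by auto
  with \<open>c \<notin> S\<close> show False by auto
qed

text \<open>The columns of \<open>X\<close> are a maximal independent set of columns of \<open>A\<close>, and \<open>Y\<close> records the coordinates of
  all columns in it. Together with \<open>rank_mult_le_inner\<close> this makes the rank the least inner dimension
  of a factorization, a description that treats rows and columns alike.\<close>

lemma (in vec_space) rank_factorization:
  assumes A: "A \<in> carrier_mat n nc"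
  shows "\<exists>X\<in>carrier_mat n (rank A). \<exists>Y\<in>carrier_mat (rank A) nc. A = X * Y"
proof -
  let ?P = "\<lambda>T. T \<subseteq> set (cols A) \<and> lin_indpt T"
  have "?P {}" by (auto simp: lin_dep_def)
  then obtain S where S: "finite S" "maximal S ?P"
    using maximal_exists_superset[of "set (cols A)" ?P "{}"] by auto
  have rk: "rank A = card S" using rank_card_indpt[OF A S(2)] .
  obtain ws where ws: "set ws = S" "distinct ws" using finite_distinct_list[OF S(1)] by blast
  have len: "length ws = rank A" using ws rk distinct_card by fastforce
  have carr: "set ws \<subseteq> carrier_vec n"
  proof -
    have "S \<subseteq> set (cols A)" using S(2) by (simp add: maximal_def)
    then show ?thesis using ws A cols_dim[of A] by auto
  qed
  define X where "X = mat_of_cols n ws"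
  have X: "X \<in> carrier_mat n (rank A)" using mat_of_cols_carrier(1)[of n ws] len by (simp add: X_def)
  have "\<exists>y\<in>carrier_vec (rank A). X *\<^sub>v y = col A j" if j: "j < nc" for j
  proof -
    have "col A j \<in> set (cols A)" using j A by (metis carrier_matD(2) cols_length cols_nth nth_mem)
    then have "col A j \<in> span (set (cols X))"
      using col_in_span_basis[OF A S(2)] ws carr by (simp add: X_def cols_mat_of_cols)
    then have "col A j \<in> col_space X" by (simp add: col_space_def)
    then show ?thesis using col_space_eq[OF X] X by auto
  qed
  then obtain y where y: "\<And>j. j < nc \<Longrightarrow> y j \<in> carrier_vec (rank A)"
      "\<And>j. j < nc \<Longrightarrow> X *\<^sub>v y j = col A j" by metis
  define Y where "Y = mat_of_cols (rank A) (map y [0..<nc])"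
  have Y: "Y \<in> carrier_mat (rank A) nc" by (simp add: Y_def mat_of_cols_def)
  have "A = X * Y"
  proof (rule mat_col_eqI)
    fix j assume "j < dim_col (X * Y)"
    then have j: "j < nc" using Y by simp
    have "col (X * Y) j = X *\<^sub>v col Y j" using X Y j by (intro col_mult2) auto
    also have "col Y j = y j" using j y by (simp add: Y_def)
    finally show "col A j = col (X * Y) j" using y j by simp
  qed (use A X Y in auto)
  then show ?thesis using X Y by blast
qed

lemma (in vec_space) rank_mult_le_inner:
  assumes X: "X \<in> carrier_mat n k" and Y: "Y \<in> carrier_mat k nc"
  shows "rank (X * Y) \<le> k"
proof -
  have carr: "set (cols (X * Y)) \<subseteq> carrier_vec n" "set (cols X) \<subseteq> carrier_vec n"
    using X Y cols_dim[of "X * Y"] cols_dim[of X] by auto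
  have sub: "set (cols (X * Y)) \<subseteq> span (set (cols X))"
  proof
    fix c assume "c \<in> set (cols (X * Y))"
    then obtain j where j: "j < nc" "c = col (X * Y) j"
      using Y by (metis carrier_matD(2) cols_length cols_nth in_set_conv_nth index_mult_mat(3))
    then have "c = X *\<^sub>v col Y j" using col_mult2[OF X Y j(1)] by (simp only:)
    then have "c \<in> col_space X" unfolding col_space_eq[OF X] using X Y j
      by (auto intro!: bexI[of _ "col Y j"])
    then show "c \<in> span (set (cols X))" by (simp add: col_space_def)
  qed
  have "span (set (cols (X * Y))) \<subseteq> span (set (cols X))"
    using span_subsetI[OF carr(2) sub] .
  then have "subspace class_ring (span (set (cols (X * Y)))) (vs (span (set (cols X))))"
    by (intro nested_subspaces span_is_subspace carr)
  then have "rank (X * Y) \<le> rank X"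
    unfolding rank_def
    using vectorspace.subspace_dim[OF subspace_is_vs[OF span_is_subspace[OF carr(2)]]]
      fin_dim_span_cols[OF X] fin_dim_span_cols[of "X * Y" nc] X Y by auto
  then show ?thesis using rank_le_nc[OF X] by simp
qed

text \<open>A factorization of \<open>Y\<close> with inner dimension \<open>rank Y\<close> yields one of \<open>X * Y * Z\<close>.\<close>

lemma rank_mult_mult_le:
  assumes X: "X \<in> carrier_mat a m" and Y: "(Y :: 'a::field mat) \<in> carrier_mat m n"
    and Z: "Z \<in> carrier_mat n b"
  shows "vec_space.rank a (X * Y * Z) \<le> vec_space.rank m Y"
proof -
  define k where "k = vec_space.rank m Y"
  obtain U W where UW: "U \<in> carrier_mat m k" "W \<in> carrier_mat k n" "Y = U * W"
    using vec_space.rank_factorization[OF Y] unfolding k_def by blast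
  have "X * (U * W) * Z = (X * U) * (W * Z)"
    using X Z UW(1,2) assoc_mult_mat[of X a m U k W n] assoc_mult_mat[of "X * U" a k W n Z b]
    by simp
  then have "X * Y * Z = (X * U) * (W * Z)" by (simp add: UW(3))
  also have "vec_space.rank a \<dots> \<le> k"
    by (rule vec_space.rank_mult_le_inner[of _ _ _ _ b]) (use X Z UW(1,2) in auto)
  finally show ?thesis by (simp add: k_def)
qed

lemma rank_equivalent:
  assumes P: "P \<in> carrier_mat m m" "P' \<in> carrier_mat m m" "P' * P = 1\<^sub>m m"
    and Q: "Q \<in> carrier_mat n n" "Q' \<in> carrier_mat n n" "Q * Q' = 1\<^sub>m n"
    and A: "(A :: 'a::field mat) \<in> carrier_mat m n"
  shows "vec_space.rank m (P * A * Q) = vec_space.rank m A"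
proof (rule antisym)
  show "vec_space.rank m (P * A * Q) \<le> vec_space.rank m A"
    using P Q A by (intro rank_mult_mult_le) auto
  have "P' * (P * A * Q) * Q' = (P' * P) * A * (Q * Q')"
    using P(1,2) Q(1,2) A
    by (simp add: assoc_mult_mat[of _ m m _ n _ n] assoc_mult_mat[of _ m m _ m _ n]
        assoc_mult_mat[of _ m n _ n _ n])
  also have "\<dots> = A" using P Q A by simp
  finally have "A = P' * (P * A * Q) * Q'" by simp
  then show "vec_space.rank m A \<le> vec_space.rank m (P * A * Q)"
    using P Q A rank_mult_mult_le[of P' m m "P * A * Q" n Q' n] by auto
qed

section \<open>Rank normal form\<close>

definition mat_equiv :: "nat \<Rightarrow> nat \<Rightarrow> 'a::field mat \<Rightarrow> 'a mat \<Rightarrow> bool" where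
  "mat_equiv m n A B \<longleftrightarrow> (\<exists>P P' Q Q'. P \<in> carrier_mat m m \<and> P' \<in> carrier_mat m m \<and>
     Q \<in> carrier_mat n n \<and> Q' \<in> carrier_mat n n \<and> P * P' = 1\<^sub>m m \<and> P' * P = 1\<^sub>m m \<and>
     Q * Q' = 1\<^sub>m n \<and> Q' * Q = 1\<^sub>m n \<and> B = P * A * Q)"

lemma inverse_product:
  assumes "P \<in> carrier_mat m m" "P' \<in> carrier_mat m m" "R \<in> carrier_mat m m" "R' \<in> carrier_mat m m"
    and "P * P' = 1\<^sub>m m" "R * R' = 1\<^sub>m m"
  shows "(P * R) * (R' * P') = (1\<^sub>m m :: 'a::field mat)"
proof -
  have "(P * R) * (R' * P') = P * ((R * R') * P')"
    using assms(1-4) by (simp add: assoc_mult_mat[of _ m m _ m _ m])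
  then show ?thesis using assms by simp
qed

lemma mat_equiv_trans:
  assumes A: "A \<in> carrier_mat m n" and "mat_equiv m n A B" and "mat_equiv m n B C"
  shows "mat_equiv m n A C"
proof -
  obtain P P' Q Q' where 1: "P \<in> carrier_mat m m" "P' \<in> carrier_mat m m"
      "Q \<in> carrier_mat n n" "Q' \<in> carrier_mat n n" "P * P' = 1\<^sub>m m" "P' * P = 1\<^sub>m m"
      "Q * Q' = 1\<^sub>m n" "Q' * Q = 1\<^sub>m n" "B = P * A * Q"
    using assms(2) unfolding mat_equiv_def by metis
  obtain R R' S S' where 2: "R \<in> carrier_mat m m" "R' \<in> carrier_mat m m"
      "S \<in> carrier_mat n n" "S' \<in> carrier_mat n n" "R * R' = 1\<^sub>m m" "R' * R = 1\<^sub>m m"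
      "S * S' = 1\<^sub>m n" "S' * S = 1\<^sub>m n" "C = R * B * S"
    using assms(3) unfolding mat_equiv_def by metis
  have "C = (R * P) * A * (Q * S)"
    unfolding 2(9) 1(9) using 1(1,3) 2(1,3) A
    by (simp add: assoc_mult_mat[of _ m m _ m _ n] assoc_mult_mat[of _ m m _ n _ n]
        assoc_mult_mat[of _ m n _ n _ n])
  moreover have "(R * P) * (P' * R') = 1\<^sub>m m" "(P' * R') * (R * P) = 1\<^sub>m m"
      "(Q * S) * (S' * Q') = 1\<^sub>m n" "(S' * Q') * (Q * S) = 1\<^sub>m n"
    using 1 2 by (auto intro!: inverse_product)
  ultimately show ?thesis unfolding mat_equiv_def using 1(1-4) 2(1-4)
    by (intro exI[of _ "R * P"] exI[of _ "P' * R'"] exI[of _ "Q * S"] exI[of _ "S' * Q'"]) simp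
qed

lemma transpose_inverse:
  assumes "P \<in> carrier_mat m m" "P' \<in> carrier_mat m m" and "P' * P = 1\<^sub>m m"
  shows "transpose_mat P * transpose_mat P' = (1\<^sub>m m :: 'a::field mat)"
  using transpose_mult[OF assms(2,1)] unfolding assms(3) by simp

text \<open>Lets column operations be performed as row operations on the transpose.\<close>

lemma mat_equiv_transpose:
  assumes A: "A \<in> carrier_mat m n" and "mat_equiv m n A B"
  shows "mat_equiv n m (transpose_mat A) (transpose_mat B)"
proof -
  obtain P P' Q Q' where 1: "P \<in> carrier_mat m m" "P' \<in> carrier_mat m m"
      "Q \<in> carrier_mat n n" "Q' \<in> carrier_mat n n" "P * P' = 1\<^sub>m m" "P' * P = 1\<^sub>m m"
      "Q * Q' = 1\<^sub>m n" "Q' * Q = 1\<^sub>m n" "B = P * A * Q"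
    using assms(2) unfolding mat_equiv_def by metis
  have "transpose_mat B = transpose_mat Q * transpose_mat A * transpose_mat P"
    using 1(1,3) A unfolding 1(9)
    by (simp add: transpose_mult[of _ m n _ n] transpose_mult[of _ m m _ n]
        assoc_mult_mat[of _ n n _ m _ m])
  moreover have "transpose_mat P * transpose_mat P' = 1\<^sub>m m"
      "transpose_mat P' * transpose_mat P = 1\<^sub>m m"
      "transpose_mat Q * transpose_mat Q' = 1\<^sub>m n"
      "transpose_mat Q' * transpose_mat Q = 1\<^sub>m n"
    using 1 by (auto intro: transpose_inverse)
  ultimately show ?thesis unfolding mat_equiv_def using 1(1-4)
    by (intro exI[of _ "transpose_mat Q"] exI[of _ "transpose_mat Q'"]
        exI[of _ "transpose_mat P"] exI[of _ "transpose_mat P'"]) simp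
qed

lemma mat_equiv_mult_left:
  assumes "A \<in> carrier_mat m n" and "P \<in> carrier_mat m m" "P' \<in> carrier_mat m m"
    and "P * P' = 1\<^sub>m m" "P' * P = 1\<^sub>m m"
  shows "mat_equiv m n A (P * A)"
  unfolding mat_equiv_def using assms
  by (intro exI[of _ P] exI[of _ P'] exI[of _ "1\<^sub>m n"]) simp

lemma mat_equiv_swaprows:
  assumes "A \<in> carrier_mat m n" and "k < m" and "l < m"
  shows "mat_equiv m n A (swaprows k l A)"
  unfolding swaprows_mat[OF assms]
  using assms by (intro mat_equiv_mult_left[of _ _ _ _ "swaprows_mat m k l"] swaprows_mat_inv) auto

definition add_row_multiples :: "nat \<Rightarrow> (nat \<Rightarrow> 'a::field) \<Rightarrow> 'a mat \<Rightarrow> 'a mat" where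
  "add_row_multiples k a A =
     mat (dim_row A) (dim_col A) (\<lambda>(i,j). A $$ (i,j) + a i * A $$ (k,j))"

lemma add_row_multiples_mult:
  assumes C: "C \<in> carrier_mat m n" and k: "k < m"
  shows "add_row_multiples k a (1\<^sub>m m) * C = add_row_multiples k a C"
proof (rule eq_matI)
  fix i j assume "i < dim_row (add_row_multiples k a C)" "j < dim_col (add_row_multiples k a C)"
  then have ij: "i < m" "j < n" using C by (auto simp: add_row_multiples_def)
  have "(add_row_multiples k a (1\<^sub>m m) * C) $$ (i,j)
      = (\<Sum>l<m. ((if i = l then 1 else 0) + a i * (if k = l then 1 else 0)) * C $$ (l,j))"
    using C k ij by (simp add: add_row_multiples_def scalar_prod_def atLeast0LessThan)
  also have "\<dots> = (\<Sum>l<m. (if i = l then C $$ (l,j) else 0) + (if k = l then a i * C $$ (l,j) else 0))"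
    by (rule sum.cong) (auto simp: algebra_simps)
  also have "\<dots> = C $$ (i,j) + a i * C $$ (k,j)"
    using ij k by (simp add: sum.distrib)
  finally show "(add_row_multiples k a (1\<^sub>m m) * C) $$ (i,j) = add_row_multiples k a C $$ (i,j)"
    using C ij by (simp add: add_row_multiples_def)
qed (use C in \<open>auto simp: add_row_multiples_def\<close>)

text \<open>Adding \<open>a i\<close> times row \<open>k\<close> to every row \<open>i\<close>, row \<open>k\<close> included, is multiplication by a rank one
  perturbation \<open>1 + a e\<^sub>k\<^sup>T\<close> of the identity. Its inverse is \<open>1 - a e\<^sub>k\<^sup>T / (1 + a k)\<close>, so one step both
  scales a pivot row and clears the pivot column.\<close>

lemma mat_equiv_add_row_multiples:
  assumes A: "A \<in> carrier_mat m n" and k: "k < m" and a: "1 + a k \<noteq> 0"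
  shows "mat_equiv m n A (add_row_multiples k a A)"
proof -
  let ?b = "\<lambda>i. - a i / (1 + a k)"
  let ?P = "add_row_multiples k a (1\<^sub>m m)" and ?P' = "add_row_multiples k ?b (1\<^sub>m m)"
  have carr: "add_row_multiples k c (1\<^sub>m m) \<in> carrier_mat m m" for c :: "nat \<Rightarrow> 'a"
    by (simp add: add_row_multiples_def)
  have bk: "1 + ?b k = 1 / (1 + a k)" using a by (simp add: field_simps)
  have comp: "add_row_multiples k c (1\<^sub>m m) * add_row_multiples k d (1\<^sub>m m) = 1\<^sub>m m"
    if cd: "\<And>i. d i + c i * (1 + d k) = 0" for c d :: "nat \<Rightarrow> 'a"
    unfolding add_row_multiples_mult[OF carr k]
  proof (rule eq_matI)
    fix i j assume "i < dim_row (1\<^sub>m m :: 'a mat)" "j < dim_col (1\<^sub>m m :: 'a mat)"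
    then show "add_row_multiples k c (add_row_multiples k d (1\<^sub>m m)) $$ (i,j) = 1\<^sub>m m $$ (i,j)"
      using cd[of i] k by (cases "j = k") (auto simp: add_row_multiples_def algebra_simps)
  qed (auto simp: add_row_multiples_def)
  have "?P * ?P' = 1\<^sub>m m" by (rule comp) (simp only: bk, simp)
  moreover have "?P' * ?P = 1\<^sub>m m" by (rule comp) (use a in simp)
  ultimately show ?thesis
    using mat_equiv_mult_left[OF A carr carr] by (simp add: add_row_multiples_mult[OF A k])
qed

definition id_block :: "nat \<Rightarrow> nat \<Rightarrow> nat \<Rightarrow> 'a::field mat" where
  "id_block m n k = mat m n (\<lambda>(i,j). if i = j \<and> i < k then 1 else 0)"

text \<open>One pivoting step with the pivot at \<open>(k,k)\<close>: rows and columns with index less than \<open>k\<close> already are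
  those of the identity, and row and column \<open>k\<close> join them.\<close>

lemma mat_equiv_clear_cross:
  assumes C: "C \<in> carrier_mat m n" and k: "k < m" "k < n"
    and part: "\<forall>i<m. \<forall>j<n. i < k \<or> j < k \<longrightarrow> C $$ (i,j) = (if i = j then 1 else 0)"
    and nz: "C $$ (k,k) \<noteq> (0 :: 'a::field)"
  shows "\<exists>D\<in>carrier_mat m n. mat_equiv m n C D \<and>
    (\<forall>i<m. \<forall>j<n. i < Suc k \<or> j < Suc k \<longrightarrow> D $$ (i,j) = (if i = j then 1 else 0))"
proof -
  \<comment> \<open>row \<open>k\<close> gets the factor \<open>1 + ?a k = 1 / C $$ (k,k)\<close>, the others lose their entry in column \<open>k\<close>\<close>
  let ?a = "\<lambda>i. if i = k then 1 / C $$ (k,k) - 1 else - C $$ (i,k) / C $$ (k,k)"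
  define E where "E = add_row_multiples k ?a C"
  have E: "E \<in> carrier_mat m n" using C by (simp add: E_def add_row_multiples_def)
  have CE: "mat_equiv m n C E"
    unfolding E_def by (rule mat_equiv_add_row_multiples[OF C k(1)]) (use nz in simp)
  have E_entry: "E $$ (i,j) = C $$ (i,j) + ?a i * C $$ (k,j)" if "i < m" "j < n" for i j
    using that C by (simp add: E_def add_row_multiples_def)
  let ?b = "\<lambda>j. if j = k then 0 else - E $$ (k,j)"
  define D where "D = transpose_mat (add_row_multiples k ?b (transpose_mat E))"
  have D: "D \<in> carrier_mat m n" using E by (simp add: D_def add_row_multiples_def)
  have "mat_equiv n m (transpose_mat E) (add_row_multiples k ?b (transpose_mat E))"
    by (rule mat_equiv_add_row_multiples) (use E k in auto)
  from mat_equiv_transpose[OF _ this] have "mat_equiv m n E D" using E by (simp add: D_def)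
  then have "mat_equiv m n C D" by (rule mat_equiv_trans[OF C CE])
  moreover have D_entry: "D $$ (i,j) = E $$ (i,j) + ?b j * E $$ (i,k)" if "i < m" "j < n" for i j
    using that E k by (simp add: D_def add_row_multiples_def)
  have E_col: "E $$ (i,k) = (if i = k then 1 else 0)" if "i < m" for i
    using that k nz by (simp add: E_entry field_simps)
  have E_part: "E $$ (i,j) = (if i = j then 1 else 0)" if "i < m" "j < n" "i < k \<or> j < k" for i j
  proof -
    have "?a i * C $$ (k,j) = 0"
    proof (cases "j < k")
      case True
      then show ?thesis using part k that by simp
    next
      case False
      then have "C $$ (i,k) = 0" "i \<noteq> k" using part k that by auto
      then show ?thesis by simp
    qed
    then have "E $$ (i,j) = C $$ (i,j)" using E_entry[OF that(1,2)] by (simp only: add_0_right)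
    then show ?thesis using part that by simp
  qed
  have "D $$ (i,j) = (if i = j then 1 else 0)" if ij: "i < m" "j < n" "i < Suc k \<or> j < Suc k" for i j
  proof -
    consider "i = k" | "j = k" | "i \<noteq> k" "j \<noteq> k" "i < k \<or> j < k" using ij by linarith
    then show ?thesis
      using D_entry E_col E_part ij k by cases auto
  qed
  ultimately show ?thesis using D by blast
qed

lemma mat_equiv_refl: "A \<in> carrier_mat m n \<Longrightarrow> mat_equiv m n A A"
  using mat_equiv_mult_left[of A m n "1\<^sub>m m" "1\<^sub>m m"] by simp

lemma mat_equiv_id_block_step:
  assumes C: "C \<in> carrier_mat m n" and "k \<le> min m n"
    and "\<forall>i<m. \<forall>j<n. i < k \<or> j < k \<longrightarrow> C $$ (i,j) = (if i = j then 1 else (0 :: 'a::field))"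
  shows "\<exists>l\<le>min m n. mat_equiv m n C (id_block m n l)"
  using assms
proof (induction "min m n - k" arbitrary: C k rule: less_induct)
  case less
  note C = less.prems(1) and part = less.prems(3)
  show ?case
  proof (cases "\<forall>i<m. \<forall>j<n. k \<le> i \<and> k \<le> j \<longrightarrow> C $$ (i,j) = 0")
    case True
    have "C = id_block m n k"
    proof (rule eq_matI)
      fix i j assume "i < dim_row (id_block m n k :: 'a mat)" "j < dim_col (id_block m n k :: 'a mat)"
      then have ij: "i < m" "j < n" by (auto simp: id_block_def)
      show "C $$ (i,j) = id_block m n k $$ (i,j)"
      proof (cases "k \<le> i \<and> k \<le> j")
        case True
        then show ?thesis using \<open>\<forall>i<m. \<forall>j<n. k \<le> i \<and> k \<le> j \<longrightarrow> C $$ (i,j) = 0\<close> ij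
          by (simp add: id_block_def)
      next
        case False
        then have "C $$ (i,j) = (if i = j then 1 else 0)" using part ij by auto
        then show ?thesis using False ij by (auto simp: id_block_def)
      qed
    qed (use C in \<open>auto simp: id_block_def\<close>)
    then show ?thesis using mat_equiv_refl[OF C] less.prems(2) by auto
  next
    case False
    then obtain p q where pq: "p < m" "q < n" "k \<le> p" "k \<le> q" "C $$ (p,q) \<noteq> 0" by auto
    then have k: "k < m" "k < n" by auto
    \<comment> \<open>move the nonzero entry at \<open>(p,q)\<close> to the pivot position \<open>(k,k)\<close>\<close>
    define E where "E = transpose_mat (swaprows k q (transpose_mat (swaprows k p C)))"
    have E: "E \<in> carrier_mat m n" using C by (auto simp: E_def)
    have sC: "swaprows k p C \<in> carrier_mat m n" using C by simp
    have "mat_equiv n m (transpose_mat (swaprows k p C)) (swaprows k q (transpose_mat (swaprows k p C)))"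
      by (rule mat_equiv_swaprows) (use sC k pq in auto)
    from mat_equiv_transpose[OF _ this] have "mat_equiv m n (swaprows k p C) E"
      using sC by (simp add: E_def)
    with mat_equiv_swaprows[OF C k(1) pq(1)] have CE: "mat_equiv m n C E"
      by (rule mat_equiv_trans[OF C])
    have E_entry: "E $$ (i,j) = C $$ (if i = k then p else if i = p then k else i,
        if j = k then q else if j = q then k else j)" if "i < m" "j < n" for i j
      using that C k pq by (simp add: E_def)
    have "E $$ (k,k) \<noteq> 0" using pq E_entry[OF k] by simp
    moreover have "\<forall>i<m. \<forall>j<n. i < k \<or> j < k \<longrightarrow> E $$ (i,j) = (if i = j then 1 else 0)"
      using part pq k by (auto simp: E_entry)
    ultimately obtain D where D: "D \<in> carrier_mat m n" "mat_equiv m n E D"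
        "\<forall>i<m. \<forall>j<n. i < Suc k \<or> j < Suc k \<longrightarrow> D $$ (i,j) = (if i = j then 1 else 0)"
      using mat_equiv_clear_cross[OF E k] by blast
    have "min m n - Suc k < min m n - k" "Suc k \<le> min m n" using k by auto
    then obtain l where "l \<le> min m n" "mat_equiv m n D (id_block m n l)"
      using less.hyps[OF _ D(1) _ D(3)] by blast
    then show ?thesis
      using mat_equiv_trans[OF C mat_equiv_trans[OF C CE D(2)]] by blast
  qed
qed

lemma id_block_mult:
  assumes "k \<le> b"
  shows "id_block a b k * id_block b c k = (id_block a c k :: 'a::field mat)"
proof (rule eq_matI)
  fix i j assume "i < dim_row (id_block a c k :: 'a mat)" "j < dim_col (id_block a c k :: 'a mat)"
  then have ij: "i < a" "j < c" by (auto simp: id_block_def)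
  let ?\<delta> = "\<lambda>i j. if i = j \<and> i < k then 1 else 0 :: 'a"
  have "(id_block a b k * id_block b c k) $$ (i,j) = (\<Sum>l<b. ?\<delta> i l * ?\<delta> l j)"
    using ij by (simp add: id_block_def scalar_prod_def atLeast0LessThan)
  also have "\<dots> = (\<Sum>l<b. if l = i then ?\<delta> i j else 0)"
    by (rule sum.cong) auto
  also have "\<dots> = ?\<delta> i j" using assms by simp
  finally show "(id_block a b k * id_block b c k) $$ (i,j) = (id_block a c k :: 'a mat) $$ (i,j)"
    using ij by (simp add: id_block_def)
qed (auto simp: id_block_def)

lemma id_block_carrier: "id_block m n k \<in> carrier_mat m n"
  by (simp add: id_block_def)

lemma rank_id_block:
  assumes "k \<le> m" and "k \<le> n"
  shows "vec_space.rank m (id_block m n k :: 'a::field mat) = k"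
proof (rule antisym)
  note carr = id_block_carrier
  have "vec_space.rank m (id_block m k k * id_block k n k :: 'a mat) \<le> k"
    by (rule vec_space.rank_mult_le_inner[OF carr carr])
  then show "vec_space.rank m (id_block m n k :: 'a mat) \<le> k" by (simp add: id_block_mult)
  have "(1\<^sub>m k :: 'a mat) = id_block k k k"
    by (rule eq_matI) (auto simp: id_block_def)
  also have "\<dots> = id_block k m k * id_block m n k * id_block n k k"
    by (simp add: id_block_mult assms)
  finally have one: "(1\<^sub>m k :: 'a mat) = id_block k m k * id_block m n k * id_block n k k" .
  have "vec_space.rank k (id_block k m k * id_block m n k * id_block n k k :: 'a mat)
      \<le> vec_space.rank m (id_block m n k :: 'a mat)"
    by (rule rank_mult_mult_le[OF carr carr carr])
  moreover have "vec_space.rank k (1\<^sub>m k :: 'a mat) = k"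
    using vec_space.low_rank_det_zero[of "1\<^sub>m k :: 'a mat" k] by simp
  ultimately show "k \<le> vec_space.rank m (id_block m n k :: 'a mat)"
    unfolding one[symmetric] by simp
qed

lemma mat_equiv_rank:
  assumes "A \<in> carrier_mat m n" and "mat_equiv m n A B"
  shows "vec_space.rank m B = vec_space.rank m (A :: 'a::field mat)"
proof -
  obtain P P' Q Q' where 1: "P \<in> carrier_mat m m" "P' \<in> carrier_mat m m"
      "Q \<in> carrier_mat n n" "Q' \<in> carrier_mat n n" "P * P' = 1\<^sub>m m" "P' * P = 1\<^sub>m m"
      "Q * Q' = 1\<^sub>m n" "Q' * Q = 1\<^sub>m n" "B = P * A * Q"
    using assms(2) unfolding mat_equiv_def by metis
  then show ?thesis using rank_equivalent[OF 1(1,2,6,3,4,7) assms(1)] by simp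
qed

text \<open>The rank normal form. The size of the block found by elimination is the rank, since equivalence
  preserves the rank.\<close>

lemma mat_equiv_id_block:
  assumes A: "(A :: 'a::field mat) \<in> carrier_mat m n"
  shows "mat_equiv m n A (id_block m n (vec_space.rank m A))"
    and "vec_space.rank m A \<le> min m n"
proof -
  obtain l where l: "l \<le> min m n" "mat_equiv m n A (id_block m n l)"
    using mat_equiv_id_block_step[OF A, of 0] by auto
  have "vec_space.rank m A = l" 
    using mat_equiv_rank[OF A l(2)] rank_id_block[of l m n, where ?'a = 'a] l(1) by linarith
  with l show "mat_equiv m n A (id_block m n (vec_space.rank m A))" "vec_space.rank m A \<le> min m n"
    by auto
qed

section \<open>Linear spaces without fixed vectors\<close>

text \<open>If \<open>v\<close> avoids the kernels of the functionals treated so far and \<open>w\<close> that of a new one, then on the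
  line \<open>v + t w\<close> each functional rules out at most one \<open>t\<close>: it is nonzero at \<open>v\<close> or at \<open>w\<close>.
  There are more field elements than functionals, so some \<open>t\<close> remains.\<close>

lemma avoid_hyperplanes:
  fixes \<phi> :: "'i \<Rightarrow> 'j \<Rightarrow> 'a::field"
  assumes "finite I" and "finite J"
    and "\<forall>i\<in>I. \<exists>j\<in>J. \<phi> i j \<noteq> 0"
    and "infinite (UNIV :: 'a set) \<or> card I < card (UNIV :: 'a set)"
  shows "\<exists>v. \<forall>i\<in>I. (\<Sum>j\<in>J. \<phi> i j * v j) \<noteq> 0"
  using assms(1,3,4)
proof (induction I rule: finite_induct)
  case (insert i I)
  let ?e = "\<lambda>i v. \<Sum>j\<in>J. \<phi> i j * v j"
  have "infinite (UNIV :: 'a set) \<or> card I < card (UNIV :: 'a set)"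
    using insert by auto
  then obtain v where v: "\<forall>i\<in>I. ?e i v \<noteq> 0" using insert by auto
  obtain j where j: "j \<in> J" "\<phi> i j \<noteq> 0" using insert by auto
  define w where "w = (\<lambda>l. if l = j then 1 else 0 :: 'a)"
  have "?e i w = \<phi> i j" using j assms(2) by (simp add: w_def if_distrib cong: if_cong)
  with j have w: "?e i w \<noteq> 0" by simp
  define bad where "bad = (\<lambda>i. - ?e i v / ?e i w) ` insert i I"
  have "finite bad" "card bad \<le> card (insert i I)"
    using insert.hyps unfolding bad_def by (blast, intro card_image_le) simp
  then have "bad \<noteq> UNIV" using insert.prems by auto
  then obtain t where t: "t \<notin> bad" by auto
  have lin: "?e l (\<lambda>j. v j + t * w j) = ?e l v + t * ?e l w" for l
    by (simp add: algebra_simps sum.distrib sum_distrib_left)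
  have "?e l v + t * ?e l w \<noteq> 0" if "l \<in> insert i I" for l
  proof (cases "?e l w = 0")
    case True
    then show ?thesis using v w that by auto
  next
    case False
    show ?thesis
    proof
      assume "?e l v + t * ?e l w = 0"
      then have "t = - ?e l v / ?e l w"
        using False by (simp add: field_simps eq_neg_iff_add_eq_0)
      then show False using t that by (auto simp: bad_def)
    qed
  qed
  then show ?case using lin by (intro exI[of _ "\<lambda>j. v j + t * w j"]) auto
qed auto

text \<open>Square blocks are treated as functions on an index set, so that deleting a row and a column with the
  same index \<open>r\<close> only means passing from \<open>I\<close> to \<open>I - {r}\<close>, without renumbering. Entries outside the
  index set are ignored throughout.\<close>

definition linear_arrays :: "('i \<Rightarrow> 'j \<Rightarrow> 'a::field) set \<Rightarrow> bool" where
  "linear_arrays V \<longleftrightarrow> (\<lambda>i j. 0) \<in> V \<and> (\<forall>X\<in>V. \<forall>Y\<in>V. (\<lambda>i j. X i j + Y i j) \<in> V) \<and>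
     (\<forall>c. \<forall>X\<in>V. (\<lambda>i j. c * X i j) \<in> V)"

lemma linear_arrays_add:
  "linear_arrays V \<Longrightarrow> X \<in> V \<Longrightarrow> Y \<in> V \<Longrightarrow> (\<lambda>i j. X i j + Y i j) \<in> V"
  by (simp add: linear_arrays_def)

lemma linear_arrays_sum:
  assumes V: "linear_arrays V" and "finite L" and "\<And>l. l \<in> L \<Longrightarrow> X l \<in> V"
  shows "(\<lambda>i j. \<Sum>l\<in>L. c l * X l i j) \<in> V"
  using assms(2,3)
proof (induction L rule: finite_induct)
  case empty
  then show ?case using V by (simp add: linear_arrays_def)
next
  case (insert l L)
  then have "(\<lambda>i j. c l * X l i j) \<in> V" using V by (simp add: linear_arrays_def)
  moreover have "(\<lambda>i j. \<Sum>l\<in>L. c l * X l i j) \<in> V" using insert by auto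
  ultimately have "(\<lambda>i j. c l * X l i j + (\<Sum>l\<in>L. c l * X l i j)) \<in> V"
    by (rule linear_arrays_add[OF V])
  then show ?case using insert by simp
qed

text \<open>For a linear space this says that no array in it has a nonzero eigenvalue in the field.\<close>

definition fixed_point_free_on :: "'i set \<Rightarrow> ('i \<Rightarrow> 'i \<Rightarrow> 'a::field) set \<Rightarrow> bool" where
  "fixed_point_free_on I V \<longleftrightarrow>
     (\<forall>X\<in>V. \<forall>v. (\<forall>i\<in>I. (\<Sum>j\<in>I. X i j * v j) = v i) \<longrightarrow> (\<forall>i\<in>I. v i = 0))"

lemma fixed_point_free_onD:
  "fixed_point_free_on I V \<Longrightarrow> X \<in> V \<Longrightarrow> (\<And>i. i \<in> I \<Longrightarrow> (\<Sum>j\<in>I. X i j * v j) = v i) \<Longrightarrow>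
     i \<in> I \<Longrightarrow> v i = 0"
  unfolding fixed_point_free_on_def by blast

text \<open>Otherwise, for each \<open>r\<close> in \<open>I\<close> there is an array in \<open>V\<close> with \<open>\<phi>\<^sub>r \<noteq> 0\<close> in row \<open>r\<close> and zeros elsewhere.
  Choose \<open>v\<close> with \<open>\<phi>\<^sub>r v \<noteq> 0\<close> for all \<open>r\<close>. Scaling the \<open>r\<close>-th array by \<open>v r / \<phi>\<^sub>r v\<close> and adding up gives an
  array in \<open>V\<close> that fixes \<open>v\<close>.\<close>

lemma row_without_single_row_array:
  fixes V :: "('i \<Rightarrow> 'i \<Rightarrow> 'a::field) set"
  assumes I: "finite I" "I \<noteq> {}" and V: "linear_arrays V" and free: "fixed_point_free_on I V"
    and size: "infinite (UNIV :: 'a set) \<or> card I < card (UNIV :: 'a set)"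
  shows "\<exists>r\<in>I. \<forall>X\<in>V. (\<forall>i\<in>I - {r}. \<forall>j\<in>I. X i j = 0) \<longrightarrow> (\<forall>j\<in>I. X r j = 0)"
proof (rule ccontr)
  assume "\<not> ?thesis"
  then have "\<forall>r\<in>I. \<exists>X. X \<in> V \<and> (\<forall>i\<in>I - {r}. \<forall>j\<in>I. X i j = 0) \<and> (\<exists>j\<in>I. X r j \<noteq> 0)"
    by blast
  then obtain X where X: "\<And>r. r \<in> I \<Longrightarrow> X r \<in> V"
      "\<And>r i j. r \<in> I \<Longrightarrow> i \<in> I \<Longrightarrow> i \<noteq> r \<Longrightarrow> j \<in> I \<Longrightarrow> X r i j = 0"
      "\<And>r. r \<in> I \<Longrightarrow> \<exists>j\<in>I. X r r j \<noteq> 0"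
    by (auto simp: bchoice_iff)
  obtain v where v: "\<forall>r\<in>I. (\<Sum>j\<in>I. X r r j * v j) \<noteq> 0"
    using avoid_hyperplanes[of I I "\<lambda>r. X r r"] I size X(3) by blast
  define c where "c r = v r / (\<Sum>j\<in>I. X r r j * v j)" for r
  define Y where "Y = (\<lambda>i j. \<Sum>r\<in>I. c r * X r i j)"
  have Y: "Y \<in> V" unfolding Y_def using linear_arrays_sum[OF V I(1)] X(1) by blast
  have "(\<Sum>j\<in>I. Y i j * v j) = v i" if i: "i \<in> I" for i
  proof -
    have "Y i j = c i * X i i j" if "j \<in> I" for j
    proof -
      have "Y i j = (\<Sum>r\<in>I. if r = i then c i * X i i j else 0)"
        unfolding Y_def by (rule sum.cong) (auto simp: X(2) i that)
      then show ?thesis using I i by simp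
    qed
    then have "(\<Sum>j\<in>I. Y i j * v j) = c i * (\<Sum>j\<in>I. X i i j * v j)"
      by (simp add: sum_distrib_left mult.assoc)
    then show ?thesis using v i by (simp add: c_def)
  qed
  then have "\<forall>i\<in>I. v i = 0" using free Y unfolding fixed_point_free_on_def by blast
  then have "\<forall>r\<in>I. (\<Sum>j\<in>I. X r r j * v j) = 0" by simp
  with v I show False by auto
qed

text \<open>Induction on the index set: take \<open>r\<close> from the previous lemma and let \<open>W\<close> consist of the arrays whose
  column \<open>r\<close> vanishes off the diagonal. On \<open>W\<close> the diagonal entry at \<open>r\<close> vanishes too, as it is an
  eigenvalue. Then deleting row and column \<open>r\<close> keeps \<open>W\<close> free of fixed vectors, and it loses no
  information: an array in the kernel of the deletion is supported in row \<open>r\<close>. The column costs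
  \<open>card I - 1\<close> entries.\<close>

lemma fixed_point_free_coordinates:
  fixes V :: "('i \<Rightarrow> 'i \<Rightarrow> 'a::field) set"
  assumes "finite I" and "linear_arrays V" and "fixed_point_free_on I V"
    and "infinite (UNIV :: 'a set) \<or> card I < card (UNIV :: 'a set)"
  shows "\<exists>J\<subseteq>I \<times> I. card J \<le> card I choose 2 \<and>
    (\<forall>X\<in>V. (\<forall>(i,j)\<in>J. X i j = 0) \<longrightarrow> (\<forall>i\<in>I. \<forall>j\<in>I. X i j = 0))"
  using assms
proof (induction "card I" arbitrary: I V)
  case 0
  then show ?case by (intro exI[of _ "{}"]) auto
next
  case (Suc n)
  note V = Suc.prems(2) and free = Suc.prems(3)
  have fin: "finite I" and "I \<noteq> {}" using Suc by auto
  obtain r where r: "r \<in> I" and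
    row: "\<forall>X\<in>V. (\<forall>i\<in>I - {r}. \<forall>j\<in>I. X i j = 0) \<longrightarrow> (\<forall>j\<in>I. X r j = 0)"
    using row_without_single_row_array[OF fin \<open>I \<noteq> {}\<close> V free] Suc.prems(4) by blast
  let ?I = "I - {r}"
  define W where "W = {X \<in> V. \<forall>i\<in>?I. X i r = 0}"
  have sum_split: "(\<Sum>j\<in>I. f j) = f r + (\<Sum>j\<in>?I. f j)" for f :: "'i \<Rightarrow> 'a"
    using fin r by (simp add: sum.remove)
  have W: "linear_arrays W" using V by (auto simp: linear_arrays_def W_def)
  have diag: "X r r = 0" if X: "X \<in> W" for X
  proof (rule ccontr)
    assume nz: "X r r \<noteq> 0"
    let ?Y = "\<lambda>i j. inverse (X r r) * X i j"
    let ?v = "\<lambda>i. if i = r then 1 else 0 :: 'a"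
    have "?Y \<in> V" using X V by (auto simp: linear_arrays_def W_def)
    moreover have "\<forall>i\<in>I. (\<Sum>j\<in>I. ?Y i j * ?v j) = ?v i"
      using X nz fin r by (auto simp: sum_split W_def)
    ultimately have "?v r = 0" using r by (intro fixed_point_free_onD[OF free, of ?Y ?v]) auto
    then show False by simp
  qed
  have "fixed_point_free_on ?I W"
    unfolding fixed_point_free_on_def
  proof (intro ballI allI impI)
    fix X v i assume X: "X \<in> W" and v: "\<forall>i\<in>?I. (\<Sum>j\<in>?I. X i j * v j) = v i" and i: "i \<in> ?I"
    \<comment> \<open>a fixed vector of the smaller array extends to one of \<open>X\<close>, as column \<open>r\<close> of \<open>X\<close> is zero\<close>
    let ?v = "v(r := \<Sum>j\<in>?I. X r j * v j)"
    have eq: "(\<Sum>j\<in>?I. X l j * ?v j) = (\<Sum>j\<in>?I. X l j * v j)" for l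
      by (rule sum.cong) auto
    have "\<forall>l\<in>I. (\<Sum>j\<in>I. X l j * ?v j) = ?v l"
    proof
      fix l assume l: "l \<in> I"
      have "X l r = 0" using X l diag[OF X] by (cases "l = r") (auto simp: W_def)
      then show "(\<Sum>j\<in>I. X l j * ?v j) = ?v l" using v l unfolding sum_split eq by auto
    qed
    moreover have "X \<in> V" using X by (simp add: W_def)
    ultimately have "\<forall>l\<in>I. ?v l = 0" using free unfolding fixed_point_free_on_def by blast
    then show "v i = 0" using i by auto
  qed
  moreover have n: "card ?I = n" using Suc r by simp
  moreover have "infinite (UNIV :: 'a set) \<or> card ?I < card (UNIV :: 'a set)"
    using Suc.prems(4) Suc.hyps(2) n by auto
  ultimately obtain J where J: "J \<subseteq> ?I \<times> ?I" "card J \<le> n choose 2"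
      "\<forall>X\<in>W. (\<forall>(i,j)\<in>J. X i j = 0) \<longrightarrow> (\<forall>i\<in>?I. \<forall>j\<in>?I. X i j = 0)"
    using Suc.hyps(1)[of ?I W] fin W by auto
  let ?J = "J \<union> (\<lambda>i. (i, r)) ` ?I"
  have "card ?J \<le> card J + card ((\<lambda>i. (i, r)) ` ?I)" by (rule card_Un_le)
  also have "\<dots> \<le> (n choose 2) + n"
    using J n card_image_le[of ?I "\<lambda>i. (i, r)"] fin by (intro add_mono) auto
  also have "\<dots> = card I choose 2"
    using Suc.hyps(2)[symmetric] by (simp add: numeral_2_eq_2)
  finally have "card ?J \<le> card I choose 2" .
  moreover have "?J \<subseteq> I \<times> I" using J r by auto
  moreover have "\<forall>i\<in>I. \<forall>j\<in>I. X i j = 0" if X: "X \<in> V" and zero: "\<forall>(i,j)\<in>?J. X i j = 0" for X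
  proof -
    have XW: "X \<in> W" using X zero by (auto simp: W_def)
    then have "\<forall>i\<in>?I. \<forall>j\<in>?I. X i j = 0" using J(3) zero by auto
    then have rest: "\<forall>i\<in>?I. \<forall>j\<in>I. X i j = 0" using XW by (auto simp: W_def)
    with row X have "\<forall>j\<in>I. X r j = 0" by blast
    with rest show ?thesis by auto
  qed
  ultimately show ?case by (intro exI[of _ ?J]) auto
qed

section \<open>Totally isotropic spaces\<close>

text \<open>A totally isotropic subspace of the hyperbolic space on \<open>T\<close> has dimension at most \<open>card T\<close>, with the
  separating entries made explicit: an \<open>x\<close>-entry or a \<open>y\<close>-entry for each \<open>t\<close>. Let \<open>J\<close> be minimal such
  that the \<open>x\<close>-entries in \<open>J\<close> separate the elements \<open>(u, 0)\<close> of \<open>W\<close>. By minimality, for each \<open>j\<close> in \<open>J\<close>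
  some such \<open>u\<close> meets \<open>J\<close> only in \<open>j\<close>. Adding it to an element \<open>(x, y)\<close> with \<open>y = 0\<close> off \<open>J\<close> changes the form
  by \<open>u j * y j\<close>, so \<open>y j = 0\<close>.\<close>

lemma isotropic_coordinates:
  fixes W :: "(('t \<Rightarrow> 'a::field) \<times> ('t \<Rightarrow> 'a)) set"
  assumes T: "finite T"
    and add: "\<And>x y x' y'. (x, y) \<in> W \<Longrightarrow> (x', y') \<in> W \<Longrightarrow> (\<lambda>t. x t + x' t, \<lambda>t. y t + y' t) \<in> W"
    and iso: "\<And>x y. (x, y) \<in> W \<Longrightarrow> (\<Sum>t\<in>T. x t * y t) = 0"
  shows "\<exists>J\<subseteq>T. \<forall>x y. (x, y) \<in> W \<longrightarrow> (\<forall>t\<in>J. x t = 0) \<longrightarrow> (\<forall>t\<in>T - J. y t = 0) \<longrightarrow>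
    (\<forall>t\<in>T. x t = 0 \<and> y t = 0)"
proof -
  define sep where "sep J \<longleftrightarrow> J \<subseteq> T \<and> (\<forall>x y. (x, y) \<in> W \<longrightarrow> (\<forall>t\<in>T. y t = 0) \<longrightarrow>
    (\<forall>t\<in>J. x t = 0) \<longrightarrow> (\<forall>t\<in>T. x t = 0))" for J
  have sepD: "\<forall>t\<in>T. x t = 0" if "sep J" "(x, y) \<in> W" "\<forall>t\<in>T. y t = 0" "\<forall>t\<in>J. x t = 0" for J x y
    using that unfolding sep_def by auto
  have "sep T" by (auto simp: sep_def)
  then obtain J where J: "sep J" and min: "\<And>J'. card J' < card J \<Longrightarrow> \<not> sep J'"
    using ex_has_least_nat[of sep T card] by (metis not_le)
  have JT: "J \<subseteq> T" and "finite J" using J T by (auto simp: sep_def intro: finite_subset)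
  have "\<forall>t\<in>T. x t = 0 \<and> y t = 0"
    if xy: "(x, y) \<in> W" and xJ: "\<forall>t\<in>J. x t = 0" and yJ: "\<forall>t\<in>T - J. y t = 0" for x y
  proof -
    have "y j = 0" if j: "j \<in> J" for j
    proof -
      have "\<not> sep (J - {j})" using j \<open>finite J\<close> by (intro min) (rule card_Diff1_less)
      then obtain u z where u: "(u, z) \<in> W" "\<forall>t\<in>T. z t = 0" "\<forall>t\<in>J - {j}. u t = 0"
          "\<exists>t\<in>T. u t \<noteq> 0"
        using JT unfolding sep_def by auto
      have uj: "u j \<noteq> 0"
      proof
        assume "u j = 0"
        then have "\<forall>t\<in>J. u t = 0" using u by auto
        with sepD[OF J u(1)] u show False by auto
      qed
      have "0 = (\<Sum>t\<in>T. (x t + u t) * (y t + z t))" using iso[OF add[OF xy u(1)]] by simp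
      also have "\<dots> = (\<Sum>t\<in>T. x t * y t) + (\<Sum>t\<in>T. u t * y t)"
        using u(2) by (simp add: distrib_right sum.distrib)
      also have "\<dots> = (\<Sum>t\<in>T. if t = j then u j * y j else 0)"
      proof -
        have "u t * y t = (if t = j then u j * y j else 0)" if "t \<in> T" for t
          using u(3) yJ that by (cases "t \<in> J") auto
        then show ?thesis using iso[OF xy] by (simp cong: sum.cong)
      qed
      also have "\<dots> = u j * y j" using j JT T by auto
      finally show ?thesis using uj by simp
    qed
    then have y: "\<forall>t\<in>T. y t = 0" using yJ by auto
    with sepD[OF J xy] xJ show ?thesis by auto
  qed
  then show ?thesis using JT by blast
qed

section \<open>Affine spaces with a lower bound on the rank\<close>

text \<open>Rearranging, copying and deleting rows and columns, and padding with zeros, are multiplications from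
  both sides. Hence none of them raises the rank.\<close>

lemma selection_matrices:
  fixes f g :: "nat \<Rightarrow> nat"
  assumes "\<And>p. p < a \<Longrightarrow> d p \<Longrightarrow> f p < m" and "\<And>q. q < b \<Longrightarrow> e q \<Longrightarrow> g q < n"
  shows "\<exists>E\<in>carrier_mat a m. \<exists>F\<in>carrier_mat n b. \<forall>X\<in>carrier_mat m n.
    E * X * F = mat a b (\<lambda>(p,q). if d p \<and> e q then X $$ (f p, g q) else (0 :: 'a::field))"
proof -
  let ?E = "mat a m (\<lambda>(p,i). if i = f p \<and> d p then 1 else 0 :: 'a)"
  let ?F = "mat n b (\<lambda>(j,q). if j = g q \<and> e q then 1 else 0 :: 'a)"
  have "?E * X * ?F = mat a b (\<lambda>(p,q). if d p \<and> e q then X $$ (f p, g q) else 0)" (is "_ = ?R")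
    if X: "X \<in> carrier_mat m n" for X
  proof (rule eq_matI)
    fix p q assume "p < dim_row ?R" "q < dim_col ?R"
    then have pq: "p < a" "q < b" by auto
    have EX: "(?E * X) $$ (p,j) = (if d p then X $$ (f p, j) else 0)" if "j < n" for j
    proof -
      have "(?E * X) $$ (p,j) = (\<Sum>i<m. (if i = f p \<and> d p then 1 else 0) * X $$ (i,j))"
        using that X pq by (simp add: scalar_prod_def atLeast0LessThan)
      also have "\<dots> = (\<Sum>i<m. if i = f p then (if d p then X $$ (f p, j) else 0) else 0)"
        by (rule sum.cong) auto
      finally show ?thesis using assms(1)[OF pq(1)] by auto
    qed
    have "(?E * X * ?F) $$ (p,q) = (\<Sum>j<n. (?E * X) $$ (p,j) * (if j = g q \<and> e q then 1 else 0))"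
      using X pq by (simp add: scalar_prod_def atLeast0LessThan)
    also have "\<dots> = (\<Sum>j<n. if j = g q then (if d p \<and> e q then X $$ (f p, g q) else 0) else 0)"
      by (rule sum.cong) (auto simp: EX)
    also have "\<dots> = (if d p \<and> e q then X $$ (f p, g q) else 0)"
      using assms(2)[OF pq(2)] by auto
    finally show "(?E * X * ?F) $$ (p,q) = ?R $$ (p,q)" using pq by simp
  qed (use X in auto)
  then show ?thesis by (intro bexI[of _ ?E] bexI[of _ ?F] ballI) auto
qed

lemma rank_selection_le:
  assumes X: "(X :: 'a::field mat) \<in> carrier_mat m n"
    and "\<And>p. p < a \<Longrightarrow> d p \<Longrightarrow> f p < m" and "\<And>q. q < b \<Longrightarrow> e q \<Longrightarrow> g q < n"
  shows "vec_space.rank a (mat a b (\<lambda>(p,q). if d p \<and> e q then X $$ (f p, g q) else 0))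
    \<le> vec_space.rank m X"
proof -
  obtain E F where EF: "E \<in> carrier_mat a m" "F \<in> carrier_mat n b"
      "E * X * F = mat a b (\<lambda>(p,q). if d p \<and> e q then X $$ (f p, g q) else 0)"
    using selection_matrices[of a d f m b e g n, where ?'a = 'a] assms by blast
  show ?thesis using rank_mult_mult_le[OF EF(1) X EF(2)] unfolding EF(3) .
qed

lemma mult_mult_add_mat:
  assumes "P \<in> carrier_mat a m" "Q \<in> carrier_mat n b"
    and "(A :: 'a::field mat) \<in> carrier_mat m n" "B \<in> carrier_mat m n"
  shows "P * (A + B) * Q = P * A * Q + P * B * Q"
  using assms by (simp add: mult_add_distrib_mat[of P a m] add_mult_distrib_mat[of _ a n _ _ b])

lemma mult_mult_smult_mat:
  assumes "P \<in> carrier_mat a m" "Q \<in> carrier_mat n b" and "(A :: 'a::field mat) \<in> carrier_mat m n"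
  shows "P * (c \<cdot>\<^sub>m A) * Q = c \<cdot>\<^sub>m (P * A * Q)"
  using assms by (simp add: mult_smult_distrib[of P a m] mult_smult_assoc_mat[of _ a n _ b])

lemma mat_functional_mult:
  assumes P: "P \<in> carrier_mat a m" and Q: "Q \<in> carrier_mat n b" and f: "mat_functional a b f"
  shows "mat_functional m n (\<lambda>B. f (P * B * Q))"
proof -
  have "P * A * Q \<in> carrier_mat a b" if "A \<in> carrier_mat m n" for A
    using that P Q by simp
  then show ?thesis
    using f mult_mult_add_mat[OF P Q] mult_mult_smult_mat[OF P Q] unfolding mat_functional_def by auto
qed

lemma choose_two_square: "(k choose 2) + (Suc k choose 2) = k * k"
  by (induction k) (simp_all add: numeral_2_eq_2)

lemma cancel_invertible:
  assumes "P \<in> carrier_mat m m" "P' \<in> carrier_mat m m" "P' * P = 1\<^sub>m m"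
    and "Q \<in> carrier_mat n n" "Q' \<in> carrier_mat n n" "Q * Q' = 1\<^sub>m n"
    and B: "(B :: 'a::field mat) \<in> carrier_mat m n" and zero: "P * B * Q = 0\<^sub>m m n"
  shows "B = 0\<^sub>m m n"
proof -
  have "P' * (P * B * Q) * Q' = (P' * P) * B * (Q * Q')"
    using assms(1,2,4,5) B
    by (simp add: assoc_mult_mat[of _ m m _ n _ n] assoc_mult_mat[of _ m m _ m _ n]
        assoc_mult_mat[of _ m n _ n _ n])
  also have "\<dots> = B" using assms(3,6) B by simp
  finally have "B = P' * (P * B * Q) * Q'" by simp
  also have "\<dots> = 0\<^sub>m m n" unfolding zero using assms(1,2,4,5) by simp
  finally show ?thesis .
qed

text \<open>Let \<open>k \<ge> s\<close> be the minimal rank, attained at the identity block of size \<open>k\<close>. The \<open>m n - k\<^sup>2\<close> entries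
  outside the block cut out a space of \<open>k\<close> by \<open>k\<close> blocks \<open>X\<close>. If \<open>X\<close> fixed a nonzero vector, \<open>1 - X\<close> would be
  singular and the rank would drop below \<open>k\<close>. So \<open>k (k - 1) / 2\<close> further entries suffice, and
  \<open>k\<^sup>2 - k (k - 1) / 2 = k (k + 1) / 2\<close>.\<close>

lemma separated_if_rank_ge:
  fixes A :: "'a::field mat"
  assumes A: "A \<in> carrier_mat m n" and V: "linear_mats m n V"
    and ge: "\<And>B. B \<in> V \<Longrightarrow> s \<le> vec_space.rank m (A + B)"
    and size: "infinite (UNIV :: 'a set) \<or> min m n < card (UNIV :: 'a set)"
  shows "separated m n V (m * n - (Suc s choose 2))"
proof -
  have VM: "V \<subseteq> carrier_mat m n" and V0: "0\<^sub>m m n \<in> V"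
    and Vadd: "\<And>B C. B \<in> V \<Longrightarrow> C \<in> V \<Longrightarrow> B + C \<in> V" and Vsm: "\<And>c B. B \<in> V \<Longrightarrow> c \<cdot>\<^sub>m B \<in> V"
    using V by (auto simp: linear_mats_def)
  obtain B0 where B0: "B0 \<in> V"
      "\<And>B. B \<in> V \<Longrightarrow> vec_space.rank m (A + B0) \<le> vec_space.rank m (A + B)"
    using ex_has_least_nat[of "\<lambda>B. B \<in> V" "0\<^sub>m m n" "\<lambda>B. vec_space.rank m (A + B)"] V0 by auto
  define A0 where "A0 = A + B0"
  define k where "k = vec_space.rank m A0"
  have A0: "A0 \<in> carrier_mat m n" using A B0 VM by (auto simp: A0_def)
  have sk: "s \<le> k" using ge[OF B0(1)] by (simp add: k_def A0_def)
  have kle: "k \<le> min m n" using mat_equiv_id_block(2)[OF A0] by (simp add: k_def)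
  have ge_k: "k \<le> vec_space.rank m (A0 + B)" if "B \<in> V" for B
  proof -
    have "A0 + B = A + (B0 + B)" unfolding A0_def using A B0(1) that VM by (intro assoc_add_mat) auto
    then show ?thesis using B0(2)[OF Vadd[OF B0(1) that]] by (simp add: k_def A0_def)
  qed
  have "mat_equiv m n A0 (id_block m n k)" using mat_equiv_id_block(1)[OF A0] by (simp add: k_def)
  then obtain P P' Q Q' where P: "P \<in> carrier_mat m m" "P' \<in> carrier_mat m m" "P' * P = 1\<^sub>m m"
      and Q: "Q \<in> carrier_mat n n" "Q' \<in> carrier_mat n n" "Q * Q' = 1\<^sub>m n"
      and PQ: "id_block m n k = P * A0 * Q"
    unfolding mat_equiv_def by metis
  define U where "U B = P * B * Q" for B
  have U: "U B \<in> carrier_mat m n" if "B \<in> V" for B using that P Q VM by (auto simp: U_def)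
  have U_add: "U (B + C) = U B + U C" if "B \<in> carrier_mat m n" "C \<in> carrier_mat m n" for B C
    unfolding U_def using mult_mult_add_mat[OF P(1) Q(1) that] .
  have U_smult: "U (c \<cdot>\<^sub>m B) = c \<cdot>\<^sub>m U B" if "B \<in> carrier_mat m n" for c B
    unfolding U_def using mult_mult_smult_mat[OF P(1) Q(1) that] .
  define W where "W = {X. \<exists>B\<in>V. \<forall>i<m. \<forall>j<n. U B $$ (i,j) = (if i < k \<and> j < k then X i j else 0)}"
  have W: "linear_arrays W"
    unfolding linear_arrays_def
  proof (intro conjI allI ballI)
    show "(\<lambda>i j. 0) \<in> W"
      using V0 P Q by (auto simp: W_def U_def intro!: bexI[of _ "0\<^sub>m m n"])
    fix X assume "X \<in> W"
    then obtain B where B: "B \<in> V" "\<forall>i<m. \<forall>j<n. U B $$ (i,j) = (if i < k \<and> j < k then X i j else 0)"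
      by (auto simp: W_def)
    {
      fix Y assume "Y \<in> W"
      then obtain C where C: "C \<in> V" "\<forall>i<m. \<forall>j<n. U C $$ (i,j) = (if i < k \<and> j < k then Y i j else 0)"
        by (auto simp: W_def)
      have "U (B + C) = U B + U C" using B C VM by (intro U_add) auto
      then show "(\<lambda>i j. X i j + Y i j) \<in> W"
        using B C Vadd[OF B(1) C(1)] U[OF B(1)] U[OF C(1)]
        by (auto simp: W_def intro!: bexI[of _ "B + C"])
    }
    fix c
    have "U (c \<cdot>\<^sub>m B) = c \<cdot>\<^sub>m U B" using B VM by (intro U_smult) auto
    then show "(\<lambda>i j. c * X i j) \<in> W"
      using B Vsm[OF B(1)] U[OF B(1)] by (auto simp: W_def intro!: bexI[of _ "c \<cdot>\<^sub>m B"])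
  qed
  have "fixed_point_free_on {..<k} W"
    unfolding fixed_point_free_on_def
  proof (intro ballI allI impI, rule ccontr)
    fix X v i
    assume "X \<in> W" and fix_v: "\<forall>i\<in>{..<k}. (\<Sum>j\<in>{..<k}. X i j * v j) = v i"
      and i: "i \<in> {..<k}" "v i \<noteq> 0"
    then obtain B where B: "B \<in> V" "\<forall>i<m. \<forall>j<n. U B $$ (i,j) = (if i < k \<and> j < k then X i j else 0)"
      by (auto simp: W_def)
    define Y where "Y = mat k k (\<lambda>(i,j). (if i = j then 1 else 0) - X i j)"
    have Y: "Y \<in> carrier_mat k k" by (simp add: Y_def)
    have "Y *\<^sub>v vec k v = 0\<^sub>v k"
    proof (rule eq_vecI)
      fix i assume i: "i < dim_vec (0\<^sub>v k :: 'a vec)"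
      have "(Y *\<^sub>v vec k v) $ i = (\<Sum>j<k. (if i = j then v j else 0) - X i j * v j)"
        using i by (auto simp: Y_def scalar_prod_def atLeast0LessThan left_diff_distrib intro!: sum.cong)
      also have "\<dots> = 0" using i fix_v by (simp add: sum_subtractf)
      finally show "(Y *\<^sub>v vec k v) $ i = 0\<^sub>v k $ i" using i by simp
    qed (simp add: Y_def)
    moreover have "vec k v \<noteq> 0\<^sub>v k" using i by (metis index_vec index_zero_vec(1) lessThan_iff)
    ultimately have "det Y = 0" using det_0_iff_vec_prod_zero_field[OF Y] by (metis vec_carrier)
    then have "vec_space.rank k Y < k" by (rule vec_space.det_zero_low_rank[OF Y])
    moreover have "U (A0 + (- 1) \<cdot>\<^sub>m B) = mat m n (\<lambda>(i,j). if i < k \<and> j < k then Y $$ (i, j) else 0)"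
    proof -
      have "U (A0 + (- 1) \<cdot>\<^sub>m B) = id_block m n k + (- 1) \<cdot>\<^sub>m U B"
      proof -
        have "id_block m n k = U A0" by (simp add: PQ U_def)
        moreover have "B \<in> carrier_mat m n" using B(1) VM by auto
        ultimately show ?thesis using A0 by (simp add: U_add U_smult)
      qed
      also have "\<dots> = mat m n (\<lambda>(i,j). if i < k \<and> j < k then Y $$ (i, j) else 0)"
        by (rule eq_matI) (use B U[OF B(1)] in \<open>auto simp: id_block_def Y_def\<close>)
      finally show ?thesis .
    qed
    then have "vec_space.rank m (U (A0 + (- 1) \<cdot>\<^sub>m B)) \<le> vec_space.rank k Y"
      using rank_selection_le[OF Y, of m "\<lambda>i. i < k" "\<lambda>i. i" n "\<lambda>i. i < k" "\<lambda>i. i"] by simp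
    moreover have "vec_space.rank m (U (A0 + (- 1) \<cdot>\<^sub>m B)) = vec_space.rank m (A0 + (- 1) \<cdot>\<^sub>m B)"
      unfolding U_def using P Q A0 B(1) VM by (intro rank_equivalent[of P m P' Q n Q']) auto
    ultimately show False using ge_k[OF Vsm[OF B(1)], of "- 1"] by simp
  qed
  moreover have "infinite (UNIV :: 'a set) \<or> card {..<k} < card (UNIV :: 'a set)"
    using size kle by auto
  ultimately obtain J where J: "J \<subseteq> {..<k} \<times> {..<k}" "card J \<le> k choose 2"
      "\<forall>X\<in>W. (\<forall>(i,j)\<in>J. X i j = 0) \<longrightarrow> (\<forall>i\<in>{..<k}. \<forall>j\<in>{..<k}. X i j = 0)"
    using fixed_point_free_coordinates[OF _ W, of "{..<k}"] by auto
  define R where "R = J \<union> ({..<m} \<times> {..<n} - {..<k} \<times> {..<k})"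
  define \<phi> where "\<phi> = (\<lambda>p B. U B $$ p)"
  have finR: "finite R" using J(1) by (auto simp: R_def intro: finite_subset)
  have "card R \<le> card J + card ({..<m} \<times> {..<n} - {..<k} \<times> {..<k})"
    unfolding R_def by (rule card_Un_le)
  also have "card ({..<m} \<times> {..<n} - {..<k} \<times> {..<k}) = m * n - k * k"
    using kle by (subst card_Diff_subset) (auto simp: card_cartesian_product)
  also have "card J + (m * n - k * k) \<le> m * n - (Suc k choose 2)"
  proof -
    have "k * k \<le> m * n" using kle by (intro mult_le_mono) auto
    then show ?thesis using J(2) choose_two_square[of k] by linarith
  qed
  also have "\<dots> \<le> m * n - (Suc s choose 2)"
    using sk by (intro diff_le_mono2) (auto simp: choose_two intro!: div_le_mono add_mono mult_le_mono)
  finally have "card (\<phi> ` R) \<le> m * n - (Suc s choose 2)"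
    using card_image_le[OF finR, of \<phi>] by linarith
  moreover have "mat_functional m n f" if f: "f \<in> \<phi> ` R" for f
  proof -
    obtain p where p: "p \<in> R" "f = \<phi> p" using f by blast
    obtain i j where "p = (i,j)" by (cases p)
    with p have ij: "(i,j) \<in> R" "f = \<phi> (i,j)" by simp_all
    then have "i < m" "j < n" using J(1) kle by (auto simp: R_def)
    then show ?thesis unfolding ij(2) \<phi>_def U_def using P Q by (intro mat_functional_mult mat_functional_entry) auto
  qed
  moreover have "B = 0\<^sub>m m n" if B: "B \<in> V" and zero: "\<forall>f\<in>\<phi> ` R. f B = 0" for B
  proof -
    have z: "U B $$ (i,j) = 0" if "(i,j) \<in> R" for i j using zero that by (force simp: \<phi>_def)
    have "(\<lambda>i j. U B $$ (i,j)) \<in> W"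
      using B z by (auto simp: W_def R_def intro!: bexI[of _ B])
    moreover have "\<forall>(i,j)\<in>J. U B $$ (i,j) = 0" using z by (auto simp: R_def)
    ultimately have "\<forall>i\<in>{..<k}. \<forall>j\<in>{..<k}. U B $$ (i,j) = 0"
      by (intro J(3)[THEN bspec, of "\<lambda>i j. U B $$ (i,j)", THEN mp])
    then have "P * B * Q = 0\<^sub>m m n"
      unfolding U_def[symmetric] by (intro eq_matI) (use U[OF B] z in \<open>auto simp: R_def\<close>)
    then show ?thesis using cancel_invertible[OF P Q] B VM by auto
  qed
  ultimately show ?thesis unfolding separated_def using finR
    by (intro exI[of _ "\<phi> ` R"]) auto
qed

section \<open>Affine spaces with bounds on both sides\<close>

text \<open>The Schur complement \<open>b - l c\<close> of the identity block is the determinant. The proof reads it off a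
  kernel vector.\<close>

lemma bordered_identity_singular:
  fixes b :: "'a::field"
  assumes "det (mat (Suc r) (Suc r) (\<lambda>(p,q). if p < r then (if q < r then if p = q then 1 else 0 else c p)
    else (if q < r then l q else b))) = 0" (is "det ?M = 0")
  shows "b = (\<Sum>q<r. l q * c q)"
proof -
  obtain v where v: "v \<in> carrier_vec (Suc r)" "v \<noteq> 0\<^sub>v (Suc r)" "?M *\<^sub>v v = 0\<^sub>v (Suc r)"
    using assms det_0_iff_vec_prod_zero_field[of ?M "Suc r"] by auto
  have row: "(\<Sum>q<r. ?M $$ (p,q) * v $ q) + ?M $$ (p,r) * v $ r = 0" if "p < Suc r" for p
  proof -
    have "(?M *\<^sub>v v) $ p = (\<Sum>q<Suc r. ?M $$ (p,q) * v $ q)"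
      using that v(1) by (simp add: scalar_prod_def atLeast0LessThan del: sum.lessThan_Suc)
    then show ?thesis using v(3) that by simp
  qed
  have vp: "v $ p = - c p * v $ r" if "p < r" for p
  proof -
    have "(\<Sum>q<r. ?M $$ (p,q) * v $ q) = (\<Sum>q<r. if q = p then v $ q else 0)"
      by (rule sum.cong) (use that in auto)
    then show ?thesis using row[of p] that by (simp add: eq_neg_iff_add_eq_0)
  qed
  have "v $ r \<noteq> 0"
  proof
    assume "v $ r = 0"
    then have "v $ p = 0" if "p < Suc r" for p using vp[of p] that by (cases "p = r") auto
    then have "v = 0\<^sub>v (Suc r)" using v(1) by (intro eq_vecI) auto
    with v(2) show False by simp
  qed
  moreover have "(b - (\<Sum>q<r. l q * c q)) * v $ r = 0"
  proof -
    have "(\<Sum>q<r. ?M $$ (r,q) * v $ q) = (\<Sum>q<r. - (l q * c q) * v $ r)"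
      by (rule sum.cong) (auto simp: vp)
    also have "\<dots> = - (\<Sum>q<r. l q * c q) * v $ r"
      by (simp only: sum_distrib_right[symmetric] sum_negf)
    finally show ?thesis using row[of r] by (simp add: left_diff_distrib)
  qed
  ultimately show ?thesis by simp
qed

lemma poly_eq_0_if_many_roots:
  fixes p :: "'a::field poly"
  assumes "\<And>t. poly p t = 0" and "degree p < d"
    and "infinite (UNIV :: 'a set) \<or> d \<le> card (UNIV :: 'a set)"
  shows "p = 0"
proof (rule ccontr)
  assume "p \<noteq> 0"
  from poly_roots_finite[OF this] card_poly_roots_bound[OF this] assms show False by auto
qed

text \<open>Border the identity block with row \<open>i\<close> and column \<open>j\<close> to get an \<open>(r+1)\<close>-minor of the pencil. It is \<open>t\<close>
  times the determinant of a matrix \<open>M\<close> over the polynomial ring, where the last row has been divided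
  by \<open>t\<close>. As the minor is the zero polynomial, \<open>det M = 0\<close>, and at \<open>t = 0\<close> this says \<open>B $$ (i,j) = 0\<close>.
  Then the last column of \<open>M\<close> is divisible by \<open>t\<close> as well; dividing gives \<open>N\<close>, and \<open>det N = 0\<close> at
  \<open>t = 0\<close> is the second claim.\<close>

lemma rank_pencil_blocks:
  fixes B :: "'a::field mat"
  assumes B: "B \<in> carrier_mat m n" and r: "r \<le> m" "r \<le> n"
    and rank: "\<And>t. vec_space.rank m (id_block m n r + t \<cdot>\<^sub>m B) \<le> r"
    and size: "infinite (UNIV :: 'a set) \<or> r + 2 \<le> card (UNIV :: 'a set)"
    and ij: "r \<le> i" "i < m" "r \<le> j" "j < n"
  shows "B $$ (i,j) = 0" and "(\<Sum>l<r. B $$ (i,l) * B $$ (l,j)) = 0"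
proof -
  define e where "e p q = (if p = q then 1 else 0 :: 'a)" for p q :: nat
  define M :: "'a poly mat" where "M = mat (Suc r) (Suc r) (\<lambda>(p,q).
      if p < r then (if q < r then [:e p q, B $$ (p,q):] else [:0, B $$ (p,j):])
      else (if q < r then [:B $$ (i,q):] else [:B $$ (i,j):]))"
  define N :: "'a poly mat" where "N = mat (Suc r) (Suc r) (\<lambda>(p,q).
      if p < r then (if q < r then [:e p q, B $$ (p,q):] else [:B $$ (p,j):])
      else (if q < r then [:B $$ (i,q):] else 0))"
  have M: "M \<in> carrier_mat (Suc r) (Suc r)" and N: "N \<in> carrier_mat (Suc r) (Suc r)"
    by (auto simp: M_def N_def)
  have eval: "poly (det X) t = det (map_mat (\<lambda>p. poly p t) X)"
    for X :: "'a poly mat" and t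
  proof -
    interpret ev: comm_ring_hom "\<lambda>p. poly p t :: 'a" by unfold_locales auto
    show ?thesis by (simp add: ev.hom_det)
  qed
  \<comment> \<open>the degree is at most \<open>r + 1\<close>, so \<open>r + 2\<close> roots force the minor to vanish\<close>
  have "det (multrow r [:0,1:] M) = 0"
  proof (rule poly_eq_0_if_many_roots[OF _ _ size])
    have "degree (det (multrow r [:0,1:] M)) \<le> 1 * Suc r"
      by (rule degree_det_le) (auto simp: M_def)
    then show "degree (det (multrow r [:0,1:] M)) < r + 2" by simp
    fix t
    define f where "f p = (if p < r then p else i)" for p
    define g where "g q = (if q < r then q else j)" for q
    let ?X = "id_block m n r + t \<cdot>\<^sub>m B"
    have X: "?X \<in> carrier_mat m n" using B by (simp add: id_block_def)
    have "map_mat (\<lambda>p. poly p t) (multrow r [:0,1:] M)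
        = mat (Suc r) (Suc r) (\<lambda>(p,q). if True \<and> True then ?X $$ (f p, g q) else 0)"
      by (rule eq_matI)
        (use ij B r in \<open>auto simp: M_def f_def g_def e_def id_block_def\<close>)
    moreover have "vec_space.rank (Suc r) (mat (Suc r) (Suc r)
        (\<lambda>(p,q). if True \<and> True then ?X $$ (f p, g q) else 0)) \<le> vec_space.rank m ?X"
      by (rule rank_selection_le[OF X]) (use ij r in \<open>auto simp: f_def g_def\<close>)
    ultimately have "vec_space.rank (Suc r) (map_mat (\<lambda>p. poly p t) (multrow r [:0,1:] M)) \<le> r"
      using rank[of t] by simp
    then show "poly (det (multrow r [:0,1:] M)) t = 0"
      using vec_space.low_rank_det_zero[of "map_mat (\<lambda>p. poly p t) (multrow r [:0,1:] M)" "Suc r"] M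
      unfolding eval by auto
  qed
  then have detM: "det M = 0" using det_multrow[OF _ M, of r] by simp
  have "det (map_mat (\<lambda>p. poly p 0) M) = 0" using eval[of M 0] detM by simp
  also have "map_mat (\<lambda>p. poly p 0) M = mat (Suc r) (Suc r) (\<lambda>(p,q). if p < r
      then (if q < r then if p = q then 1 else 0 else 0) else (if q < r then B $$ (i,q) else B $$ (i,j)))"
    by (rule eq_matI) (auto simp: M_def e_def)
  finally have "B $$ (i,j) = (\<Sum>q<r. B $$ (i,q) * 0)" by (rule bordered_identity_singular)
  then show Bij: "B $$ (i,j) = 0" by simp
  have "M = multcol r [:0,1:] N"
    by (rule eq_matI) (auto simp: M_def N_def Bij)
  then have "det N = 0"
    using detM multcol_mat[OF N, of r "[:0,1:]"] det_mult[OF N, of "multrow_mat (Suc r) r [:0,1:]"]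
      det_multrow_mat[of r "Suc r" "[:0,1:] :: 'a poly"] by simp
  then have "det (map_mat (\<lambda>p. poly p 0) N) = 0" using eval[of N 0] by simp
  also have "map_mat (\<lambda>p. poly p 0) N = mat (Suc r) (Suc r) (\<lambda>(p,q). if p < r
      then (if q < r then if p = q then 1 else 0 else B $$ (p,j)) else (if q < r then B $$ (i,q) else 0))"
    by (rule eq_matI) (auto simp: N_def e_def)
  finally have "0 = (\<Sum>q<r. B $$ (i,q) * B $$ (q,j))" by (rule bordered_identity_singular)
  then show "(\<Sum>l<r. B $$ (i,l) * B $$ (l,j)) = 0" by simp
qed

text \<open>In coordinates in which \<open>A\<close> is the identity block, three groups of functionals separate \<open>V\<close>. Each of the
  first \<open>k = min (m - r) (n - r)\<close> rows below the block is paired with a column right of it; by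
  isotropy \<open>k r\<close> entries kill both. The \<open>\<bar>m - n\<bar> r\<close> entries of the unpaired rows or columns make it
  \<open>r (max m n - r)\<close>. The remaining \<open>r\<close> by \<open>r\<close> blocks are separated by \<open>r\<^sup>2 - s (s + 1) / 2\<close> functionals,
  because adding the identity to them gives an affine space of rank at least \<open>s\<close>.\<close>

lemma separated_if_rank_between:
  fixes A :: "'a::field mat"
  assumes A: "A \<in> carrier_mat m n" and rankA: "vec_space.rank m A = r" and V: "linear_mats m n V"
    and ge: "\<And>B. B \<in> V \<Longrightarrow> s \<le> vec_space.rank m (A + B)"
    and le: "\<And>B. B \<in> V \<Longrightarrow> vec_space.rank m (A + B) \<le> r"
    and size: "infinite (UNIV :: 'a set) \<or> r + 2 \<le> card (UNIV :: 'a set)"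
  shows "separated m n V (r * max m n - (Suc s choose 2))"
proof -
  have VM: "V \<subseteq> carrier_mat m n" and V0: "0\<^sub>m m n \<in> V"
    and Vadd: "\<And>B C. B \<in> V \<Longrightarrow> C \<in> V \<Longrightarrow> B + C \<in> V" and Vsm: "\<And>c B. B \<in> V \<Longrightarrow> c \<cdot>\<^sub>m B \<in> V"
    using V by (auto simp: linear_mats_def)
  have r: "r \<le> m" "r \<le> n" using mat_equiv_id_block(2)[OF A] rankA by auto
  have "mat_equiv m n A (id_block m n r)" using mat_equiv_id_block(1)[OF A] rankA by simp
  then obtain P P' Q Q' where P: "P \<in> carrier_mat m m" "P' \<in> carrier_mat m m" "P' * P = 1\<^sub>m m"
      and Q: "Q \<in> carrier_mat n n" "Q' \<in> carrier_mat n n" "Q * Q' = 1\<^sub>m n"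
      and PQ: "id_block m n r = P * A * Q"
    unfolding mat_equiv_def by metis
  define U where "U B = P * B * Q" for B
  have U: "U B \<in> carrier_mat m n" if "B \<in> V" for B using that P Q VM by (auto simp: U_def)
  have U_add: "U (B + C) = U B + U C" if "B \<in> carrier_mat m n" "C \<in> carrier_mat m n" for B C
    unfolding U_def using mult_mult_add_mat[OF P(1) Q(1) that] .
  have U_smult: "U (c \<cdot>\<^sub>m B) = c \<cdot>\<^sub>m U B" if "B \<in> carrier_mat m n" for c B
    unfolding U_def using mult_mult_smult_mat[OF P(1) Q(1) that] .
  have rankU: "vec_space.rank m (id_block m n r + U B) = vec_space.rank m (A + B)" if "B \<in> V" for B
  proof -
    have "id_block m n r + U B = U (A + B)" using A that VM by (subst U_add) (auto simp: PQ U_def)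
    moreover have "A + B \<in> carrier_mat m n" using A that VM by auto
    ultimately show ?thesis using rank_equivalent[OF P Q] by (simp add: U_def)
  qed
  have blocks: "U B $$ (i,j) = 0" "(\<Sum>l<r. U B $$ (i,l) * U B $$ (l,j)) = 0"
    if B: "B \<in> V" and ij: "r \<le> i" "i < m" "r \<le> j" "j < n" for B i j
  proof -
    have "vec_space.rank m (id_block m n r + t \<cdot>\<^sub>m U B) \<le> r" for t
    proof -
      have "t \<cdot>\<^sub>m U B = U (t \<cdot>\<^sub>m B)" using B VM by (subst U_smult) auto
      then show ?thesis using le[OF Vsm[OF B]] rankU[OF Vsm[OF B]] by simp
    qed
    from rank_pencil_blocks[OF U[OF B] r this size ij]
    show "U B $$ (i,j) = 0" "(\<Sum>l<r. U B $$ (i,l) * U B $$ (l,j)) = 0" by auto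
  qed
  define k where "k = min (m - r) (n - r)"
  define T where "T = {..<k} \<times> {..<r}"
  \<comment> \<open>row \<open>r + a\<close> left of, and column \<open>r + a\<close> above, the zero block, paired by the form\<close>
  define x where "x B = (\<lambda>(a,l). U B $$ (r + a, l))" for B
  define y where "y B = (\<lambda>(a,l). U B $$ (l, r + a))" for B
  \<comment> \<open>entries off \<open>T\<close> are set to 0 to make the map from \<open>V\<close> additive as a map into functions\<close>
  define W where "W = {(\<lambda>t. if t \<in> T then x B t else 0, \<lambda>t. if t \<in> T then y B t else 0) | B. B \<in> V}"
  have idx: "r + a < m" "r + a < n" if "a < k" for a using that by (auto simp: k_def)
  have iso: "\<exists>J\<subseteq>T. \<forall>u w. (u, w) \<in> W \<longrightarrow> (\<forall>t\<in>J. u t = 0) \<longrightarrow> (\<forall>t\<in>T - J. w t = 0) \<longrightarrow>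
      (\<forall>t\<in>T. u t = 0 \<and> w t = 0)"
  proof (rule isotropic_coordinates)
    show "finite T" by (simp add: T_def)
    fix u w assume "(u, w) \<in> W"
    then obtain B where B: "B \<in> V" "u = (\<lambda>t. if t \<in> T then x B t else 0)"
        "w = (\<lambda>t. if t \<in> T then y B t else 0)" by (auto simp: W_def)
    have "(\<Sum>t\<in>T. u t * w t) = (\<Sum>(a,l)\<in>{..<k} \<times> {..<r}. U B $$ (r + a, l) * U B $$ (l, r + a))"
      by (rule sum.cong) (auto simp: B T_def x_def y_def)
    also have "\<dots> = (\<Sum>a<k. \<Sum>l<r. U B $$ (r + a, l) * U B $$ (l, r + a))"
      by (simp only: sum.cartesian_product)
    also have "\<dots> = 0" using B(1) blocks(2) idx by (intro sum.neutral) auto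
    finally show "(\<Sum>t\<in>T. u t * w t) = 0" .
    fix u' w' assume "(u', w') \<in> W"
    then obtain C where C: "C \<in> V" "u' = (\<lambda>t. if t \<in> T then x C t else 0)"
        "w' = (\<lambda>t. if t \<in> T then y C t else 0)" by (auto simp: W_def)
    have "U (B + C) = U B + U C" using B C VM by (intro U_add) auto
    then have "x (B + C) t = x B t + x C t" "y (B + C) t = y B t + y C t" if "t \<in> T" for t
      using that idx r U[OF B(1)] U[OF C(1)] by (auto simp: T_def x_def y_def)
    then have "(\<lambda>t. u t + u' t) = (\<lambda>t. if t \<in> T then x (B + C) t else 0)"
        "(\<lambda>t. w t + w' t) = (\<lambda>t. if t \<in> T then y (B + C) t else 0)"
      unfolding B(2,3) C(2,3) by (auto intro!: ext)
    then show "(\<lambda>t. u t + u' t, \<lambda>t. w t + w' t) \<in> W"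
      using Vadd[OF B(1) C(1)] unfolding W_def by blast
  qed
  obtain J where J: "J \<subseteq> T" and Jiso: "\<And>u w. (u, w) \<in> W \<Longrightarrow> \<forall>t\<in>J. u t = 0 \<Longrightarrow>
      \<forall>t\<in>T - J. w t = 0 \<Longrightarrow> \<forall>t\<in>T. u t = 0 \<and> w t = 0"
    using iso by auto
  have Jsep: "x B t = 0 \<and> y B t = 0"
    if "B \<in> V" "\<forall>t\<in>J. x B t = 0" "\<forall>t\<in>T - J. y B t = 0" "t \<in> T" for B t
  proof -
    have "(\<lambda>t. if t \<in> T then x B t else 0, \<lambda>t. if t \<in> T then y B t else 0) \<in> W"
      using that(1) unfolding W_def by blast
    from Jiso[OF this] that J show ?thesis by auto
  qed
  have "\<exists>E\<in>carrier_mat r m. \<exists>F\<in>carrier_mat n r. \<forall>X\<in>carrier_mat m n.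
      E * X * F = mat r r (\<lambda>(p,q). if True \<and> True then X $$ (p,q) else (0 :: 'a))"
    using r by (intro selection_matrices) auto
  then obtain E F where EF: "E \<in> carrier_mat r m" "F \<in> carrier_mat n r"
      "\<forall>X\<in>carrier_mat m n. E * X * F = mat r r (\<lambda>(p,q). if True \<and> True then X $$ (p,q) else (0 :: 'a))"
    by blast
  define V' where "V' = {C \<in> carrier_mat r r. \<exists>B\<in>V. \<forall>i<m. \<forall>j<n.
      U B $$ (i,j) = (if i < r \<and> j < r then C $$ (i,j) else 0)}"
  have V': "linear_mats r r V'"
    unfolding linear_mats_def
  proof (intro conjI allI ballI)
    show "V' \<subseteq> carrier_mat r r" by (auto simp: V'_def)
    show "0\<^sub>m r r \<in> V'" using V0 P Q by (auto simp: V'_def U_def intro!: bexI[of _ "0\<^sub>m m n"])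
    fix C assume "C \<in> V'"
    then obtain B where B: "C \<in> carrier_mat r r" "B \<in> V"
        "\<forall>i<m. \<forall>j<n. U B $$ (i,j) = (if i < r \<and> j < r then C $$ (i,j) else 0)"
      by (auto simp: V'_def)
    {
      fix C' assume "C' \<in> V'"
      then obtain B' where B': "C' \<in> carrier_mat r r" "B' \<in> V"
          "\<forall>i<m. \<forall>j<n. U B' $$ (i,j) = (if i < r \<and> j < r then C' $$ (i,j) else 0)"
        by (auto simp: V'_def)
      have "U (B + B') = U B + U B'" using B B' VM by (intro U_add) auto
      then show "C + C' \<in> V'"
        using B B' Vadd[OF B(2) B'(2)] U[OF B(2)] U[OF B'(2)]
        by (auto simp: V'_def intro!: bexI[of _ "B + B'"])
    }
    fix c
    have "U (c \<cdot>\<^sub>m B) = c \<cdot>\<^sub>m U B" using B VM by (intro U_smult) auto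
    then show "c \<cdot>\<^sub>m C \<in> V'"
      using B Vsm[OF B(2)] U[OF B(2)] by (auto simp: V'_def intro!: bexI[of _ "c \<cdot>\<^sub>m B"])
  qed
  have "s \<le> vec_space.rank r (1\<^sub>m r + C)" if C: "C \<in> V'" for C
  proof -
    obtain B where B: "C \<in> carrier_mat r r" "B \<in> V"
        "\<forall>i<m. \<forall>j<n. U B $$ (i,j) = (if i < r \<and> j < r then C $$ (i,j) else 0)"
      using C by (auto simp: V'_def)
    have "id_block m n r + U B
        = mat m n (\<lambda>(p,q). if p < r \<and> q < r then (1\<^sub>m r + C) $$ (p, q) else 0)"
      by (rule eq_matI) (use B U[OF B(2)] in \<open>auto simp: id_block_def\<close>)
    then have "vec_space.rank m (id_block m n r + U B) \<le> vec_space.rank r (1\<^sub>m r + C)"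
      using rank_selection_le[of "1\<^sub>m r + C" r r m "\<lambda>i. i < r" "\<lambda>i. i" n "\<lambda>i. i < r" "\<lambda>i. i"] B(1)
      by simp
    then show ?thesis using rankU[OF B(2)] ge[OF B(2)] by simp
  qed
  moreover have "infinite (UNIV :: 'a set) \<or> min r r < card (UNIV :: 'a set)" using size by auto
  ultimately have "separated r r V' (r * r - (Suc s choose 2))"
    using separated_if_rank_ge[of "1\<^sub>m r" r r V' s] V' by auto
  then obtain G where G: "finite G" "card G \<le> r * r - (Suc s choose 2)"
      "\<forall>f\<in>G. mat_functional r r f" "\<forall>C\<in>V'. (\<forall>f\<in>G. f C = 0) \<longrightarrow> C = 0\<^sub>m r r"
    unfolding separated_def by metis
  define R where "R = (\<lambda>(a,l). (r + a, l)) ` J \<union> (\<lambda>(a,l). (l, r + a)) ` (T - J) \<union>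
      {r + k..<m} \<times> {..<r} \<union> {..<r} \<times> {r + k..<n}"
  define \<phi> where "\<phi> = (\<lambda>p B. U B $$ p)"
  define \<psi> where "\<psi> = (\<lambda>f B. f (E * U B * F) :: 'a)"
  have finT: "finite T" by (simp add: T_def)
  then have finR: "finite R" using J by (auto simp: R_def intro: finite_subset)
  have Rsub: "R \<subseteq> {..<m} \<times> {..<n}" using J idx r by (auto simp: R_def T_def)
  have "card R \<le> card J + card (T - J) + (m - (r + k)) * r + r * (n - (r + k))"
  proof -
    have "card R \<le> card ((\<lambda>(a,l). (r + a, l)) ` J) + card ((\<lambda>(a,l). (l, r + a)) ` (T - J))
        + card ({r + k..<m} \<times> {..<r}) + card ({..<r} \<times> {r + k..<n})"
      unfolding R_def by (meson add_mono card_Un_le le_trans order_refl)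
    moreover have "card ((\<lambda>(a,l). (r + a, l)) ` J) \<le> card J"
      by (intro card_image_le finite_subset[OF J finT])
    moreover have "card ((\<lambda>(a,l). (l, r + a)) ` (T - J)) \<le> card (T - J)"
      by (intro card_image_le) (use finT in simp)
    ultimately show ?thesis by (simp add: card_cartesian_product)
  qed
  also have "card J + card (T - J) = k * r"
    using card_mono[OF finT J] finite_subset[OF J finT] J
    by (simp add: card_Diff_subset T_def card_cartesian_product)
  also have "k * r + (m - (r + k)) * r + r * (n - (r + k)) = r * (max m n - r)"
  proof -
    have "k + (m - (r + k)) + (n - (r + k)) = max m n - r" using r by (auto simp: k_def)
    then show ?thesis by (metis add_mult_distrib2 mult.commute)
  qed
  finally have cardR: "card R \<le> r * (max m n - r)" .
  have sr: "s \<le> r" using ge[OF V0] le[OF V0] by simp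
  have small: "(Suc s choose 2) \<le> r * r"
  proof -
    have "(Suc s choose 2) \<le> s * s" using choose_two_square[of s] by linarith
    also have "\<dots> \<le> r * r" using sr by (intro mult_le_mono)
    finally show ?thesis .
  qed
  have "card (\<phi> ` R \<union> \<psi> ` G) \<le> card R + card G"
    using card_Un_le[of "\<phi> ` R" "\<psi> ` G"] card_image_le[OF finR, of \<phi>] card_image_le[OF G(1), of \<psi>]
    by linarith
  also have "\<dots> \<le> r * (max m n - r) + (r * r - (Suc s choose 2))" using cardR G(2) by linarith
  also have "\<dots> = r * max m n - (Suc s choose 2)"
  proof -
    have "r * (max m n - r) + r * r = r * max m n"
      using r by (metis add_mult_distrib2 le_add_diff_inverse2 le_max_iff_disj)
    then show ?thesis using small by linarith
  qed
  finally have "card (\<phi> ` R \<union> \<psi> ` G) \<le> r * max m n - (Suc s choose 2)" .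
  moreover have "mat_functional m n f" if "f \<in> \<phi> ` R \<union> \<psi> ` G" for f
    using that
  proof
    assume "f \<in> \<phi> ` R"
    then obtain p where p: "p \<in> R" "f = \<phi> p" by (elim imageE) simp
    obtain i j where "p = (i,j)" by (cases p)
    with p have ij: "(i,j) \<in> R" "f = \<phi> (i,j)" by simp_all
    then have "i < m" "j < n" using Rsub by auto
    then show ?thesis unfolding ij(2) \<phi>_def U_def using P Q by (intro mat_functional_mult mat_functional_entry) auto
  next
    assume "f \<in> \<psi> ` G"
    then obtain h where "h \<in> G" and h2: "f = \<psi> h" by blast
    then have h: "mat_functional r r h" using G(3) by blast
    show ?thesis unfolding h2 \<psi>_def U_def
      using mat_functional_mult[OF P(1) Q(1) mat_functional_mult[OF EF(1,2) h]] .
  qed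
  moreover have "B = 0\<^sub>m m n" if B: "B \<in> V" and zero: "\<forall>f\<in>\<phi> ` R \<union> \<psi> ` G. f B = 0" for B
  proof -
    have z: "U B $$ (i,j) = 0" if "(i,j) \<in> R" for i j using zero that by (force simp: \<phi>_def)
    have "\<forall>t\<in>J. x B t = 0" by (auto simp: x_def R_def intro!: z)
    moreover have "\<forall>t\<in>T - J. y B t = 0" by (auto simp: y_def R_def intro!: z)
    ultimately have xy: "x B t = 0 \<and> y B t = 0" if "t \<in> T" for t using Jsep[OF B] that by blast
    have lower: "U B $$ (i,j) = 0" if "r \<le> i" "i < m" "j < r" for i j
    proof (cases "i < r + k")
      case True
      then show ?thesis using xy[of "(i - r, j)"] that by (auto simp: x_def T_def)
    next
      case False
      then show ?thesis using that by (intro z) (auto simp: R_def)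
    qed
    have upper: "U B $$ (i,j) = 0" if "i < r" "r \<le> j" "j < n" for i j
    proof (cases "j < r + k")
      case True
      then show ?thesis using xy[of "(j - r, i)"] that by (auto simp: y_def T_def)
    next
      case False
      then show ?thesis using that by (intro z) (auto simp: R_def)
    qed
    have off: "U B $$ (i,j) = 0" if "i < m" "j < n" "\<not> (i < r \<and> j < r)" for i j
      using lower[of i j] upper[of i j] blocks(1)[OF B, of i j] that by (cases "i < r"; cases "j < r") auto
    let ?C = "E * U B * F"
    have C: "?C = mat r r (\<lambda>(p,q). U B $$ (p,q))" using EF(3)[rule_format, OF U[OF B]] by (simp only: if_True simp_thms)
    have "?C \<in> V'" unfolding C V'_def using B off by (auto intro!: bexI[of _ B])
    moreover have "\<forall>f\<in>G. f ?C = 0" using zero by (auto simp: \<psi>_def)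
    ultimately have "?C = 0\<^sub>m r r" using G(4) by blast
    then have zero_block: "mat r r (\<lambda>(p,q). U B $$ (p,q)) = 0\<^sub>m r r" unfolding C .
    have "U B $$ (i,j) = 0" if "i < r" "j < r" for i j
      using arg_cong[OF zero_block, of "\<lambda>X. X $$ (i,j)"] that by simp
    then have "P * B * Q = 0\<^sub>m m n"
      unfolding U_def[symmetric] by (intro eq_matI) (use U[OF B] off in auto)
    then show ?thesis using cancel_invertible[OF P Q] B VM by auto
  qed
  ultimately show ?thesis unfolding separated_def using finR G(1)
    by (intro exI[of _ "\<phi> ` R \<union> \<psi> ` G"]) auto
qed

section \<open>The maximal dimension\<close>

lemma direction_translate:
  assumes A: "A \<in> carrier_mat m n" and V: "linear_mats m n (V :: 'a::field mat set)"
  shows "direction ((\<lambda>B. A + B) ` V) = V"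
proof
  have VM: "V \<subseteq> carrier_mat m n" using V by (simp add: linear_mats_def)
  show "direction ((\<lambda>B. A + B) ` V) \<subseteq> V"
  proof
    fix D assume "D \<in> direction ((\<lambda>B. A + B) ` V)"
    then obtain B C where BC: "B \<in> V" "C \<in> V" "D = (A + C) - (A + B)"
      by (auto simp: direction_def)
    moreover from BC(1,2) VM have "B \<in> carrier_mat m n" "C \<in> carrier_mat m n" by auto
    ultimately have "D = C + (- 1) \<cdot>\<^sub>m B" using A by (intro eq_matI) auto
    then show "D \<in> V" using BC V by (simp add: linear_mats_def)
  qed
  show "V \<subseteq> direction ((\<lambda>B. A + B) ` V)"
  proof
    fix B assume B: "B \<in> V"
    then have "B \<in> carrier_mat m n" using VM by auto
    then have "B = (A + B) - (A + 0\<^sub>m m n)" using A by (intro eq_matI) auto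
    moreover have "0\<^sub>m m n \<in> V" using V by (simp add: linear_mats_def)
    ultimately show "B \<in> direction ((\<lambda>B. A + B) ` V)" using B unfolding direction_def by blast
  qed
qed

lemma finite_ranks:
  assumes "S \<subseteq> carrier_mat m n"
  shows "finite (vec_space.rank m ` (S :: 'a::field mat set))"
proof (rule finite_subset)
  show "vec_space.rank m ` S \<subseteq> {..n}" using assms vec_space.rank_le_nc[of _ m n] by auto
qed simp

text \<open>The base point may be moved to a matrix of maximal rank.\<close>

lemma affine_dim_le:
  fixes S :: "'a::field mat set"
  assumes S: "S \<in> affine_rank_spaces TYPE('a) m n s r"
    and size: "infinite (UNIV :: 'a set) \<or> card (UNIV :: 'a set) \<ge> r + 2"
  shows "affine_dim m n S \<le> r * max m n - (Suc s choose 2)"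
proof -
  obtain A V where A: "A \<in> carrier_mat m n" and V: "linear_mats m n V" and SV: "S = (\<lambda>B. A + B) ` V"
    using S by (auto simp: affine_rank_spaces_def affine_mat_subspace_def subspace_iff_linear_mats)
  have s: "s = Min (vec_space.rank m ` S)" and r: "r = Max (vec_space.rank m ` S)"
    using S by (auto simp: affine_rank_spaces_def)
  have VM: "V \<subseteq> carrier_mat m n" and V0: "0\<^sub>m m n \<in> V"
    and Vadd: "\<And>B C. B \<in> V \<Longrightarrow> C \<in> V \<Longrightarrow> B + C \<in> V"
    using V by (auto simp: linear_mats_def)
  have fin: "finite (vec_space.rank m ` S)" using A VM SV by (intro finite_ranks[of _ m n]) auto
  moreover have "vec_space.rank m ` S \<noteq> {}" using V0 SV by auto
  ultimately have "r \<in> vec_space.rank m ` S" unfolding r by (rule Max_in)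
  then obtain B0 where B0: "B0 \<in> V" "vec_space.rank m (A + B0) = r" using SV by auto
  have shift: "A + B0 + B = A + (B0 + B)" if "B \<in> V" for B
    using A B0 VM that by (intro assoc_add_mat) auto
  have "separated m n V (r * max m n - (Suc s choose 2))"
  proof (rule separated_if_rank_between[OF _ B0(2) V _ _ size])
    show "A + B0 \<in> carrier_mat m n" using A B0 VM by auto
    fix B assume B: "B \<in> V"
    then have "A + B0 + B \<in> S" using Vadd[OF B0(1) B] by (simp add: SV shift)
    then show "s \<le> vec_space.rank m (A + B0 + B)" "vec_space.rank m (A + B0 + B) \<le> r"
      unfolding s r using fin by auto
  qed
  then show ?thesis
    using dim_le_if_separated(2)[OF V] direction_translate[OF A V] by (simp add: affine_dim_def SV)
qed

lemma card_lower_triangle: "card {(i,j). j \<le> i \<and> i < s} = Suc s choose 2"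
proof -
  have "{(i,j). j \<le> i \<and> i < s} = Sigma {..<s} (\<lambda>i. {..i})" by auto
  then have "card {(i,j). j \<le> i \<and> i < s} = (\<Sum>i<s. Suc i)" by simp
  also have "\<dots> = Suc s choose 2" by (induction s) (simp_all add: numeral_2_eq_2)
  finally show ?thesis .
qed

lemma rank_unit_upper_triangular_corner:
  assumes C: "(C :: 'a::field mat) \<in> carrier_mat m n" and s: "s \<le> m" "s \<le> n"
    and tri: "\<And>i j. i < s \<Longrightarrow> j \<le> i \<Longrightarrow> C $$ (i,j) = (if i = j then 1 else 0)"
  shows "s \<le> vec_space.rank m C"
proof -
  let ?X = "mat s s (\<lambda>(p,q). if True \<and> True then C $$ (p, q) else 0)"
  have X: "?X \<in> carrier_mat s s" by simp
  have "upper_triangular ?X" using tri by (auto simp: upper_triangular_def)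
  then have "det ?X = prod_list (diag_mat ?X)" using X by (rule det_upper_triangular)
  also have "diag_mat ?X = map (\<lambda>i. 1) [0..<s]"
    unfolding diag_mat_def using tri by (intro map_cong) auto
  also have "prod_list \<dots> = (1 :: 'a)" by (induction s) auto
  finally have "vec_space.rank s ?X = s" by (intro vec_space.low_rank_det_zero[OF X]) simp
  moreover have "vec_space.rank s ?X \<le> vec_space.rank m C"
    by (rule rank_selection_le[OF C]) (use s in auto)
  ultimately show ?thesis by simp
qed

lemma rank_supported_in_corner:
  assumes C: "(C :: 'a::field mat) \<in> carrier_mat m n" and ab: "a \<le> m" "b \<le> n"
    and zero: "\<And>i j. i < m \<Longrightarrow> j < n \<Longrightarrow> \<not> (i < a \<and> j < b) \<Longrightarrow> C $$ (i,j) = 0"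
  shows "vec_space.rank m C \<le> min a b"
proof -
  let ?X = "mat a b (\<lambda>(p,q). C $$ (p,q))"
  have X: "?X \<in> carrier_mat a b" by simp
  have "C = mat m n (\<lambda>(p,q). if p < a \<and> q < b then ?X $$ (p, q) else 0)"
    by (rule eq_matI) (use C zero in auto)
  then have "vec_space.rank m C \<le> vec_space.rank a ?X"
    using rank_selection_le[OF X, of m "\<lambda>p. p < a" "\<lambda>p. p" n "\<lambda>q. q < b" "\<lambda>q. q"] by simp
  then show ?thesis using mat_equiv_id_block(2)[OF X] by linarith
qed

text \<open>The \<open>a\<close> by \<open>b\<close> corner consists of the first \<open>r\<close> columns or of the first \<open>r\<close> rows, whichever are
  longer. The base point \<open>A\<close> is the identity block of size \<open>s\<close>, and \<open>V\<close> leaves all corner entries free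
  except those on or below the diagonal in the leading \<open>s\<close> by \<open>s\<close> block.\<close>

lemma ex_affine_space_of_large_dim:
  assumes sr: "s \<le> r" "r \<le> min m n"
    and size: "infinite (UNIV :: 'a set) \<or> card (UNIV :: 'a::field set) \<ge> r + 2"
  shows "\<exists>S \<in> affine_rank_spaces TYPE('a) m n s r. r * max m n - (Suc s choose 2) \<le> affine_dim m n S"
proof -
  obtain a b where ab: "a \<le> m" "b \<le> n" "min a b = r" "a * b = r * max m n"
  proof (cases "n \<le> m")
    case True
    then show ?thesis using sr by (intro that[of m r]) (auto simp: max_def)
  next
    case False
    then show ?thesis using sr by (intro that[of r n]) (auto simp: max_def)
  qed
  have sab: "s \<le> a" "s \<le> b" using sr(1) ab(3) by auto
  define L where "L = {(i,j). j \<le> i \<and> i < s}"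
  define P where "P = {..<a} \<times> {..<b} - L"
  define V where "V = (coordinate_mats m n P :: 'a mat set)"
  define A where "A = (id_block m n s :: 'a mat)"
  define S where "S = (\<lambda>B. A + B) ` V"
  have A: "A \<in> carrier_mat m n" by (simp add: A_def id_block_carrier)
  have V: "linear_mats m n V" by (simp add: V_def linear_mats_coordinate_mats)
  have VM: "V \<subseteq> carrier_mat m n" using V by (simp add: linear_mats_def)
  have SM: "S \<subseteq> carrier_mat m n" using A VM by (auto simp: S_def)
  have bounds: "s \<le> vec_space.rank m C \<and> vec_space.rank m C \<le> r" if C: "C \<in> S" for C
  proof
    obtain B where B: "B \<in> V" "C = A + B" using C by (auto simp: S_def)
    have BM: "B \<in> carrier_mat m n" using B VM by auto
    have Bz: "B $$ (i,j) = 0" if "i < m" "j < n" "(i,j) \<notin> P" for i j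
      using B that by (simp add: V_def coordinate_mats_def)
    have entry: "C $$ (i,j) = (if i = j \<and> i < s then 1 else 0) + B $$ (i,j)" if "i < m" "j < n" for i j
      using that BM by (simp add: B(2) A_def id_block_def)
    have CM: "C \<in> carrier_mat m n" using C SM by auto
    show "s \<le> vec_space.rank m C"
      by (rule rank_unit_upper_triangular_corner[OF CM])
        (use sr in \<open>auto simp: entry Bz P_def L_def\<close>)
    show "vec_space.rank m C \<le> r"
      unfolding ab(3)[symmetric]
      by (rule rank_supported_in_corner[OF CM ab(1,2)])
        (use sab in \<open>auto simp: entry Bz P_def\<close>)
  qed
  have "0\<^sub>m m n \<in> V" using V by (simp add: linear_mats_def)
  then have "A + 0\<^sub>m m n \<in> S" unfolding S_def by blast
  then have "A \<in> S" using A by simp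
  moreover have "vec_space.rank m A = s" using sr by (simp add: A_def rank_id_block)
  ultimately have s_in: "s \<in> vec_space.rank m ` S" by blast
  have "id_block m n r + (- 1) \<cdot>\<^sub>m A \<in> V"
    using ab(3) sab by (auto simp: V_def coordinate_mats_def id_block_def A_def P_def L_def)
  moreover have "id_block m n r = A + (id_block m n r + (- 1) \<cdot>\<^sub>m A)"
    by (rule eq_matI) (auto simp: A_def id_block_def)
  ultimately have "id_block m n r \<in> S" unfolding S_def by blast
  moreover have "vec_space.rank m (id_block m n r :: 'a mat) = r" using sr by (simp add: rank_id_block)
  ultimately have r_in: "r \<in> vec_space.rank m ` S" by (metis imageI)
  have fin: "finite (vec_space.rank m ` S)" by (rule finite_ranks[OF SM])
  have "s = Min (vec_space.rank m ` S)"
    using bounds by (intro Min_eqI[symmetric] fin s_in) auto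
  moreover have "r = Max (vec_space.rank m ` S)"
    using bounds by (intro Max_eqI[symmetric] fin r_in) auto
  moreover have "affine_mat_subspace m n S"
    unfolding affine_mat_subspace_def subspace_iff_linear_mats using A V S_def by blast
  ultimately have S_in: "S \<in> affine_rank_spaces TYPE('a) m n s r"
    by (simp add: affine_rank_spaces_def)
  have "separated m n V (m * n)"
    unfolding separated_def
  proof (intro exI[of _ "(\<lambda>p B. B $$ p) ` ({..<m} \<times> {..<n})"] conjI ballI impI)
    show "card ((\<lambda>p B. B $$ p :: 'a) ` ({..<m} \<times> {..<n})) \<le> m * n"
      using card_image_le[of "{..<m} \<times> {..<n}" "\<lambda>p B. B $$ p :: 'a"]
      by (simp add: card_cartesian_product)
    fix f assume "f \<in> (\<lambda>p B. B $$ p :: 'a) ` ({..<m} \<times> {..<n})"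
    then show "mat_functional m n f" by (auto intro: mat_functional_entry)
  next
    fix B assume B: "B \<in> V" and z: "\<forall>f\<in>(\<lambda>p B. B $$ p :: 'a) ` ({..<m} \<times> {..<n}). f B = 0"
    show "B = 0\<^sub>m m n" by (rule eq_matI) (use B z VM in auto)
  qed simp
  from dim_le_if_separated(1)[OF V this]
  have "card P \<le> vectorspace.dim class_ring ((module_mat TYPE('a) m n)\<lparr>carrier := V\<rparr>)"
    unfolding V_def by (intro card_le_dim_coordinate_mats) (use ab in \<open>auto simp: P_def\<close>)
  also have "\<dots> = affine_dim m n S"
    using direction_translate[OF A V] by (simp add: affine_dim_def S_def)
  finally have "card P \<le> affine_dim m n S" .
  moreover have "r * max m n - (Suc s choose 2) \<le> card P"
  proof -
    have "finite L" by (rule finite_subset[of _ "{..<s} \<times> {..<s}"]) (auto simp: L_def)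
    then have "card ({..<a} \<times> {..<b}) - card L \<le> card P" unfolding P_def by (rule diff_card_le_card_Diff)
    then show ?thesis using ab(4) by (simp add: card_cartesian_product L_def card_lower_triangle)
  qed
  ultimately show ?thesis using S_in by (intro bexI[of _ S]) auto
qed

theorem theorem11:
  fixes r s m n :: nat
  assumes "s \<le> r" and "r \<le> min m n"
    and "infinite (UNIV :: 'a::field set) \<or> card (UNIV :: 'a set) \<ge> r + 2"
    and "CHAR('a) \<noteq> 2"
  shows "int (max_affine_dim TYPE('a) m n s r) = int r * int (max m n) - int ((s + 1) choose 2)"
proof -
  let ?N = "r * max m n - (Suc s choose 2)"
  let ?D = "affine_dim m n ` affine_rank_spaces TYPE('a) m n s r"
  have le: "d \<le> ?N" if "d \<in> ?D" for d using that affine_dim_le[OF _ assms(3)] by auto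
  obtain S where S: "S \<in> affine_rank_spaces TYPE('a) m n s r" "?N \<le> affine_dim m n S"
    using ex_affine_space_of_large_dim[OF assms(1-3)] by blast
  have "affine_dim m n S \<in> ?D" using S(1) by blast
  then have "?N \<in> ?D" using le[of "affine_dim m n S"] S(2) by simp
  moreover have "finite ?D" by (rule finite_subset[of _ "{..?N}"]) (use le in auto)
  ultimately have "max_affine_dim TYPE('a) m n s r = ?N"
    unfolding max_affine_dim_def using le by (intro Max_eqI) auto
  moreover have "(Suc s choose 2) \<le> r * max m n"
  proof -
    have "(Suc s choose 2) \<le> s * s" using choose_two_square[of s] by linarith
    also have "\<dots> \<le> r * max m n" using assms(1,2) by (intro mult_le_mono) auto
    finally show ?thesis .
  qed
  ultimately show ?thesis by (simp add: of_nat_diff)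
qed

end
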